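(* The reduction $\rightsquigarrow$ is strongly normalising on types, terms, and substitutions: there is no infinite sequence $t_0\rightsquigarrow t_1\rightsquigarrow t_2\rightsquigarrow\cdots$ of terms, nor of types, nor of substitutions.
   Context: **Raw syntax.** Fix an infinite set $V$ of variables. Contexts: $\emptyset$ or $\Gamma,(x:A)$. Substitutions: $\langle\rangle$ or $\langle\sigma,x\mapsto t\rangle$. Types: $\star$ or $s\to_A t$ ($A$ a type, $s,t$ terms). Terms: variables $x\in V$, or $\mathsf{coh}(\Gamma:A)[\sigma]$ with $\Gamma$ a context, $A$ a type, $\sigma$ a substitution. $\equiv$ is syntactic equality (names of the variables of the bound context of a $\mathsf{coh}$ matter only up to renaming). $\mathrm{Var}(\Gamma)$ is the set of variables declared in $\Gamma$. We write $\sigma:\Delta\to\Gamma$ for a substitution assigning to each variable of $\Delta$ a term over $\Gamma$; $\sigma(x)=t$ if $x\mapsto t$ occurs in $\sigma$. Substitution action (a partial operation): $x[\![\sigma]\!]=\sigma(x)$, $\star[\![\sigma]\!]=\star$, $(s\to_A t)[\![\sigma]\!]=s[\![\sigma]\!]\to_{A[\![\sigma]\!]}t[\![\sigma]\!]$, $\mathsf{coh}(\Gamma:A)[\tau][\![\sigma]\!]=\mathsf{coh}(\Gamma:A)[\sigma\circ\tau]$, where $(\sigma\circ\tau)(x)=\tau(x)[\![\sigma]\!]$. **Dimension, boundaries.** $\dim\star=0$, $\dim(s\to_A t)=\dim A+1$; $\dim\emptyset=-1$, $\dim(\Gamma,(x:A))=\max(\dim\Gamma,\dim A)$. Over an ambient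 context $\Gamma$: $\dim x=\dim A$ if $(x:A)\in\Gamma$; $\dim\mathsf{coh}(\Delta:A)[\sigma]=\dim A$. For a type $A\equiv s\to_{A'}t$ of dimension $n$ and $m<n$: $A^-_{n-1}=s$, $A^+_{n-1}=t$, and $A^\epsilon_m=(A')^\epsilon_m$ for $m<n-1$. For a term $t$: $\delta^\epsilon_n(t)=t$ if $n=\dim t$; for $n<\dim t$, $\delta^\epsilon_n(x)=A^\epsilon_n$ if $(x:A)\in\Gamma$ and $\delta^\epsilon_n(\mathsf{coh}(\Delta:A)[\sigma])=A^\epsilon_n[\![\sigma]\!]$. **Pasting contexts.** $\Gamma\vdash_{pd}$ ($\Gamma$ is a pasting context) is derived by: $(x:\star)\vdash_{pd}x:\star$; from $\Gamma\vdash_{pd}x:A$ and $y,f$ fresh, $\Gamma,(y:A),(f:x\to_Ay)\vdash_{pd}f:x\to_Ay$; from $\Gamma\vdash_{pd}f:x\to_Ay$, $\Gamma\vdash_{pd}y:A$; from $\Gamma\vdash_{pd}x:\star$, $\Gamma\vdash_{pd}$. For a pasting context of dimension $d$, $\partial^-(\Gamma)$ (resp. $\partial^+(\Gamma)$) is the subcontext of variables of dimension $<d$, omitting those of dimension $d-1$ that are the target (resp. source) of a $d$-dimensional variable. A variable of a pasting context is locally maximal if it is not a source or target (of any dimension) of another variable. **Trees.** A labelled Batanin tree $T$ is a pair $(T_l,T_b)$: $T_l$ a list of (distinct) variables, $T_b$ a list of labelled trees, $\mathrm{length}(T_l)=\mathrm{length}(T_b)+1$. If $T_l=[l_0,\dots,l_k]$,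 $T_b=[T_0,\dots,T_{k-1}]$, its context is $\lfloor T\rfloor=(l_0:\star),(l_1:\star),\Sigma_0,(l_2:\star),\Sigma_1,\dots$, where $\Sigma_i$ is $\lfloor T_i\rfloor$ with every $\star$ in its types replaced by $l_i\to_\star l_{i+1}$. This is a bijection between trees and pasting contexts, with inverse $\lceil-\rceil$. Linear height: $\mathsf{lh}(T)=1+\mathsf{lh}(t)$ if $T_b=[t]$, else $0$; $\mathsf{lh}(\Theta)=\mathsf{lh}(\lceil\Theta\rceil)$. A tree is linear if it never branches; the corresponding contexts are the discs. Lists are indexed from $0$. The branching path of a locally maximal variable $x$ of $T$: it is $[0]$ if $T_b$ is empty; otherwise $x$ occurs in the $n$-th branch, and the path is $[n]$ if this branch is linear, else $n$ followed by the branching path of $x$ in that branch. **Insertion.** $L^{[i..j]}$ is the sublist of elements $i$ to $j$; $+\!\!+$ is concatenation. For trees $S,T$ and path $p$ in $S$ with $\mathsf{lh}(T)\ge\mathrm{length}(p)-1$, define $S\ll_pT$: labels are $S_l^{[0..n-1]}+\!\!+\,T_l+\!\!+\,S_l^{[n+2..]}$ where $n$ is the head of $p$; branches are $S_b^{[0..n-1]}+\!\!+\,T_b+\!\!+\,S_b^{[n+1..]}$ if $p=[n]$, and $S_b^{[0..n-1]}+\!\!+\,[S'\ll_{p'}T']+\!\!+\,S_b^{[n+1..]}$ if $p$ has nonempty tail $p'$, where $S'$ is the $n$-th branch of $S$ and $T_b=[T']$. For pasting contexts with disjoint variables, $\Delta\ll_x\Theta=\lfloor\lceil\Delta\rceil\ll_p\lceil\Theta\rceil\rfloor$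 with $p$ the branching path of $x$. The internal substitution $\iota:\Theta\to\Delta\ll_x\Theta$ sends each variable to itself. The external substitution $\kappa=\kappa_{\Delta,x,\Theta,B}:\Delta\to\Delta\ll_x\Theta$ sends $y$ to $y$ if $y\in\mathrm{Var}(\Delta\ll_x\Theta)$; otherwise $y=\delta^\epsilon_m(x)$ for some $\epsilon,m$, and $y\mapsto\delta^\epsilon_m(\mathsf{coh}(\Theta:B)[\iota])$. For $\sigma:\Delta\to\Gamma$, $\tau:\Theta\to\Gamma$, $\sigma\ll_x\tau:\Delta\ll_x\Theta\to\Gamma$ sends variables coming from $\Theta$ to their image under $\tau$ and the others to their image under $\sigma$. **Unbiased types.** For a disc context, the unbiased term is the top-dimensional variable and the unbiased type is its type. For any other pasting context $\Gamma$, the unbiased type $UTy(\Gamma)$ is the arrow type $UTm(\partial^-\Gamma)\to UTm(\partial^+\Gamma)$ (over the type $UTy(\partial^-\Gamma)$) and the unbiased term is $UTm(\Gamma)=\mathsf{coh}(\Gamma:UTy(\Gamma))[\mathrm{id}]$. $\mathsf{coh}(\Theta:B)[\tau]$ is unbiased (an unbiased composite) if $\Theta$ is a pasting context and $B$ is its unbiased type. **Reduction.** $\rightsquigarrow$ is the one-step reduction defined mutually on types, substitutions and terms: $s\to_At$ reduces by reducing any one of $s,A,t$; a substitution reduces by reducing any one of its terms; $\mathsf{coh}(\Delta:A)[\sigma]\rightsquigarrow\mathsf{coh}(\Delta:A')[\sigma]$ if $A\rightsquigarrow A'$; $\mathsf{coh}(\Delta:A)[\sigma]\rightsquigarrow\mathsf{coh}(\Delta:A)[\sigma']$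 if $\sigma\rightsquigarrow\sigma'$; and (insertion) if $x$ is locally maximal in the pasting context $\Delta$ and $\sigma(x)\equiv\mathsf{coh}(\Theta:B)[\tau]$ is an unbiased composite with $\mathrm{length}(p)-1\le\mathsf{lh}(\Theta)$, $p$ the branching path of $x$, then $\mathsf{coh}(\Delta:A)[\sigma]\rightsquigarrow\mathsf{coh}(\Delta\ll_x\Theta:A[\![\kappa_{\Delta,x,\Theta,B}]\!])[\sigma\ll_x\tau]$ (whenever the right-hand side is defined). *)

theory Defs
  imports Main
begin

section \<open>Raw syntax\<close>

text \<open>
  Contexts and substitutions are lists read from left to right, so that the extension of
  \<open>\<Gamma>\<close> by \<open>(x : A)\<close> is \<open>\<Gamma> @ [(x, A)]\<close>.  \<open>Arr s A t\<close> is the arrow type from \<open>s\<close> to \<open>t\<close> over \<open>A\<close>,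
  and \<open>Coh \<Gamma> A \<sigma>\<close> is the term \<open>coh(\<Gamma> : A)[\<sigma>]\<close>.
\<close>

datatype 'v ty = Star | Arr "'v tm" "'v ty" "'v tm"
  and 'v tm = Var 'v | Coh "('v \<times> 'v ty) list" "'v ty" "('v \<times> 'v tm) list"

type_synonym 'v ctx = "('v \<times> 'v ty) list"
type_synonym 'v sub = "('v \<times> 'v tm) list"

definition ctx_vars :: "'v ctx \<Rightarrow> 'v set" where
  "ctx_vars \<Gamma> = fst ` set \<Gamma>"

definition id_sub :: "'v ctx \<Rightarrow> 'v sub" where
  "id_sub \<Gamma> = map (\<lambda>(x, A). (x, Var x)) \<Gamma>"

text \<open>
  Turns a list of keys with partial values into a substitution, which is defined if all of
  the values are.
\<close>

definition collect_sub :: "('v \<times> 'v tm option) list \<Rightarrow> 'v sub option" where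
  "collect_sub xs = those (map (\<lambda>(x, t). map_option (Pair x) t) xs)"

text \<open>The partial action of a substitution; the bound data \<open>\<Gamma>\<close>, \<open>A\<close> of a coherence are untouched.
  If a key is repeated, the first entry counts.\<close>

primrec subst_ty :: "'v sub \<Rightarrow> 'v ty \<Rightarrow> 'v ty option"
  and subst_tm :: "'v sub \<Rightarrow> 'v tm \<Rightarrow> 'v tm option" where
  "subst_ty \<sigma> Star = Some Star"
| "subst_ty \<sigma> (Arr s A t) =
     Option.bind (subst_tm \<sigma> s) (\<lambda>s'.
     Option.bind (subst_ty \<sigma> A) (\<lambda>A'.
     Option.bind (subst_tm \<sigma> t) (\<lambda>t'. Some (Arr s' A' t'))))"
| "subst_tm \<sigma> (Var x) = map_of \<sigma> x"
| "subst_tm \<sigma> (Coh \<Gamma> A \<tau>) =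
     map_option (Coh \<Gamma> A) (collect_sub (map (map_prod id (subst_tm \<sigma>)) \<tau>))"


section \<open>Renaming of bound contexts\<close>

text \<open>
  In \<open>Coh \<Gamma> A \<sigma>\<close> the variables of \<open>\<Gamma>\<close> are bound in the types of \<open>\<Gamma>\<close>, in \<open>A\<close>, and as the keys
  of \<open>\<sigma>\<close>; only the terms of \<open>\<sigma>\<close> live over the ambient context.
\<close>

primrec fv_ty :: "'v ty \<Rightarrow> 'v set" and fv_tm :: "'v tm \<Rightarrow> 'v set" where
  "fv_ty Star = {}"
| "fv_ty (Arr s A t) = fv_tm s \<union> fv_ty A \<union> fv_tm t"
| "fv_tm (Var x) = {x}"
| "fv_tm (Coh \<Gamma> A \<sigma>) = \<Union> (snd ` set (map (map_prod id fv_tm) \<sigma>))"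

primrec rename_ty :: "('v \<Rightarrow> 'v) \<Rightarrow> 'v ty \<Rightarrow> 'v ty"
  and rename_tm :: "('v \<Rightarrow> 'v) \<Rightarrow> 'v tm \<Rightarrow> 'v tm" where
  "rename_ty \<pi> Star = Star"
| "rename_ty \<pi> (Arr s A t) = Arr (rename_tm \<pi> s) (rename_ty \<pi> A) (rename_tm \<pi> t)"
| "rename_tm \<pi> (Var x) = Var (\<pi> x)"
| "rename_tm \<pi> (Coh \<Gamma> A \<sigma>) = Coh \<Gamma> A (map (map_prod id (rename_tm \<pi>)) \<sigma>)"

text \<open>
  The least congruence that identifies coherences differing by a renaming of the bound context.
  The side condition in \<open>alpha_rename\<close> says that \<open>\<pi>\<close> moves no variable other than those of \<open>\<Gamma>\<close>;
  as \<open>\<pi>\<close> is a bijection, nothing is captured.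
\<close>

inductive alpha_ty :: "'v ty \<Rightarrow> 'v ty \<Rightarrow> bool"
  and alpha_tm :: "'v tm \<Rightarrow> 'v tm \<Rightarrow> bool" where
  alpha_ty_refl: "alpha_ty A A"
| alpha_ty_sym: "alpha_ty A B \<Longrightarrow> alpha_ty B A"
| alpha_ty_trans: "alpha_ty A B \<Longrightarrow> alpha_ty B C \<Longrightarrow> alpha_ty A C"
| alpha_arr: "alpha_tm s s' \<Longrightarrow> alpha_ty A A' \<Longrightarrow> alpha_tm t t' \<Longrightarrow>
    alpha_ty (Arr s A t) (Arr s' A' t')"
| alpha_tm_refl: "alpha_tm t t"
| alpha_tm_sym: "alpha_tm s t \<Longrightarrow> alpha_tm t s"
| alpha_tm_trans: "alpha_tm s t \<Longrightarrow> alpha_tm t u \<Longrightarrow> alpha_tm s u"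
| alpha_coh_ctx: "alpha_ty B B' \<Longrightarrow>
    alpha_tm (Coh (\<Gamma> @ (x, B) # \<Gamma>') A \<sigma>) (Coh (\<Gamma> @ (x, B') # \<Gamma>') A \<sigma>)"
| alpha_coh_ty: "alpha_ty A A' \<Longrightarrow> alpha_tm (Coh \<Gamma> A \<sigma>) (Coh \<Gamma> A' \<sigma>)"
| alpha_coh_sub: "alpha_tm t t' \<Longrightarrow>
    alpha_tm (Coh \<Gamma> A (\<sigma> @ (x, t) # \<sigma>')) (Coh \<Gamma> A (\<sigma> @ (x, t') # \<sigma>'))"
| alpha_rename: "bij \<pi> \<Longrightarrow>
    (\<And>z. z \<in> (\<Union>(x, B) \<in> set \<Gamma>. fv_ty B) \<union> fv_ty A \<union> fst ` set \<sigma> \<Longrightarrow>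
       z \<notin> ctx_vars \<Gamma> \<Longrightarrow> \<pi> z = z) \<Longrightarrow>
    alpha_tm (Coh \<Gamma> A \<sigma>)
      (Coh (map (map_prod \<pi> (rename_ty \<pi>)) \<Gamma>) (rename_ty \<pi> A) (map (map_prod \<pi> id) \<sigma>))"

definition alpha_sub :: "'v sub \<Rightarrow> 'v sub \<Rightarrow> bool" where
  "alpha_sub = list_all2 (rel_prod (=) alpha_tm)"


section \<open>Dimension and boundaries\<close>

datatype sign = Neg | Pos

primrec dim_ty :: "'v ty \<Rightarrow> nat" where
  "dim_ty Star = 0"
| "dim_ty (Arr s A t) = dim_ty A + 1"

definition dim_ctx :: "'v ctx \<Rightarrow> int" where
  "dim_ctx \<Gamma> = foldl (\<lambda>d (x, A). max d (int (dim_ty A))) (-1) \<Gamma>"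

primrec dim_tm :: "'v ctx \<Rightarrow> 'v tm \<Rightarrow> nat option" where
  "dim_tm \<Gamma> (Var x) = map_option dim_ty (map_of \<Gamma> x)"
| "dim_tm \<Gamma> (Coh \<Delta> A \<sigma>) = Some (dim_ty A)"

text \<open>\<open>ty_bd \<epsilon> m A\<close> is undefined for \<open>m \<ge> dim_ty A\<close>.\<close>

primrec ty_bd :: "sign \<Rightarrow> nat \<Rightarrow> 'v ty \<Rightarrow> 'v tm option" where
  "ty_bd \<epsilon> m Star = None"
| "ty_bd \<epsilon> m (Arr s A t) =
     (if m = dim_ty A then Some (case \<epsilon> of Neg \<Rightarrow> s | Pos \<Rightarrow> t) else ty_bd \<epsilon> m A)"

definition tm_bd :: "'v ctx \<Rightarrow> sign \<Rightarrow> nat \<Rightarrow> 'v tm \<Rightarrow> 'v tm option" where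
  "tm_bd \<Gamma> \<epsilon> n t =
     (if dim_tm \<Gamma> t = Some n then Some t
      else case t of
        Var x \<Rightarrow> Option.bind (map_of \<Gamma> x) (ty_bd \<epsilon> n)
      | Coh \<Delta> A \<sigma> \<Rightarrow> Option.bind (ty_bd \<epsilon> n A) (subst_tm \<sigma>))"


section \<open>Pasting contexts\<close>

inductive pd :: "'v ctx \<Rightarrow> 'v \<Rightarrow> 'v ty \<Rightarrow> bool" where
  pd_point: "pd [(x, Star)] x Star"
| pd_extend: "pd \<Gamma> x A \<Longrightarrow> y \<notin> ctx_vars \<Gamma> \<Longrightarrow> f \<notin> ctx_vars \<Gamma> \<Longrightarrow> y \<noteq> f \<Longrightarrow>
    pd (\<Gamma> @ [(y, A), (f, Arr (Var x) A (Var y))]) f (Arr (Var x) A (Var y))"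
| pd_down: "pd \<Gamma> f (Arr (Var x) A (Var y)) \<Longrightarrow> pd \<Gamma> y A"

definition pasting :: "'v ctx \<Rightarrow> bool" where
  "pasting \<Gamma> \<longleftrightarrow> (\<exists>x. pd \<Gamma> x Star)"

primrec opposite :: "sign \<Rightarrow> sign" where
  "opposite Neg = Pos"
| "opposite Pos = Neg"

text \<open>
  The negative boundary drops the codimension-one targets of top-dimensional variables, the
  positive boundary drops their sources.
\<close>

definition ctx_bd :: "sign \<Rightarrow> 'v ctx \<Rightarrow> 'v ctx" where
  "ctx_bd \<epsilon> \<Gamma> = filter (\<lambda>(y, B). int (dim_ty B) < dim_ctx \<Gamma> \<and>
     \<not> (int (dim_ty B) = dim_ctx \<Gamma> - 1 \<and>
        (\<exists>(f, C) \<in> set \<Gamma>. int (dim_ty C) = dim_ctx \<Gamma> \<and>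
           ty_bd (opposite \<epsilon>) (dim_ty B) C = Some (Var y)))) \<Gamma>"

definition locally_maximal :: "'v ctx \<Rightarrow> 'v \<Rightarrow> bool" where
  "locally_maximal \<Gamma> x \<longleftrightarrow> x \<in> ctx_vars \<Gamma> \<and>
     (\<forall>(y, B) \<in> set \<Gamma>. y \<noteq> x \<longrightarrow> (\<forall>\<epsilon> m. ty_bd \<epsilon> m B \<noteq> Some (Var x)))"


section \<open>Labelled Batanin trees\<close>

datatype 'v tree = Node "'v list" "'v tree list"

fun labels :: "'v tree \<Rightarrow> 'v list" where
  "labels (Node ls ts) = ls @ concat (map labels ts)"

fun tree_shape :: "'v tree \<Rightarrow> bool" where
  "tree_shape (Node ls ts) \<longleftrightarrow> length ls = length ts + 1 \<and> (\<forall>t \<in> set ts. tree_shape t)"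

definition wf_tree :: "'v tree \<Rightarrow> bool" where
  "wf_tree T \<longleftrightarrow> tree_shape T \<and> distinct (labels T)"

primrec suspend_ty :: "'v \<Rightarrow> 'v \<Rightarrow> 'v ty \<Rightarrow> 'v ty" where
  "suspend_ty l l' Star = Arr (Var l) Star (Var l')"
| "suspend_ty l l' (Arr s A t) = Arr s (suspend_ty l l' A) t"

definition suspend_ctx :: "'v \<Rightarrow> 'v \<Rightarrow> 'v ctx \<Rightarrow> 'v ctx" where
  "suspend_ctx l l' \<Gamma> = map (map_prod id (suspend_ty l l')) \<Gamma>"

text \<open>
  \<open>branches_ctx l [l\<^sub>1, \<dots>] [T\<^sub>0, \<dots>]\<close> lists the part of the context following the
  label \<open>l\<close>.  The catch-all equations only concern trees that are not well formed.
\<close>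

fun tree_ctx :: "'v tree \<Rightarrow> 'v ctx"
  and branches_ctx :: "'v \<Rightarrow> 'v list \<Rightarrow> 'v tree list \<Rightarrow> 'v ctx" where
  "tree_ctx (Node (l # ls) ts) = (l, Star) # branches_ctx l ls ts"
| "tree_ctx (Node [] ts) = []"
| "branches_ctx l (l' # ls) (t # ts) =
     (l', Star) # suspend_ctx l l' (tree_ctx t) @ branches_ctx l' ls ts"
| "branches_ctx l _ _ = []"

definition ctx_tree :: "'v ctx \<Rightarrow> 'v tree" where
  "ctx_tree = inv_into {T. wf_tree T} tree_ctx"

fun linear_height :: "'v tree \<Rightarrow> nat" where
  "linear_height (Node ls [t]) = 1 + linear_height t"
| "linear_height (Node ls _) = 0"

fun linear :: "'v tree \<Rightarrow> bool" where
  "linear (Node ls []) = True"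
| "linear (Node ls [t]) = linear t"
| "linear (Node ls _) = False"

inductive branching_path :: "'v tree \<Rightarrow> 'v \<Rightarrow> nat list \<Rightarrow> bool" where
  "branching_path (Node ls []) x [0]"
| "n < length ts \<Longrightarrow> x \<in> set (labels (ts ! n)) \<Longrightarrow> linear (ts ! n) \<Longrightarrow>
    branching_path (Node ls ts) x [n]"
| "n < length ts \<Longrightarrow> x \<in> set (labels (ts ! n)) \<Longrightarrow> \<not> linear (ts ! n) \<Longrightarrow>
    branching_path (ts ! n) x p \<Longrightarrow> branching_path (Node ls ts) x (n # p)"


section \<open>Unbiased types and terms\<close>

definition disc :: "'v ctx \<Rightarrow> bool" where
  "disc \<Gamma> \<longleftrightarrow> pasting \<Gamma> \<and> linear (ctx_tree \<Gamma>)"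

lemma dim_ctx_less_iff: "dim_ctx \<Gamma> < d \<longleftrightarrow> -1 < d \<and> (\<forall>(x, A) \<in> set \<Gamma>. int (dim_ty A) < d)"
  by (induction \<Gamma> rule: rev_induct) (auto simp: dim_ctx_def)

lemma pd_nonempty: "pd \<Gamma> x A \<Longrightarrow> \<Gamma> \<noteq> []"
  by (induction rule: pd.induct) auto

lemma dim_ctx_nonneg: "\<Gamma> \<noteq> [] \<Longrightarrow> 0 \<le> dim_ctx \<Gamma>"
  by (cases \<Gamma> rule: rev_cases) (auto simp: dim_ctx_def)

lemma dim_ctx_bd_less: "pasting \<Gamma> \<Longrightarrow> dim_ctx (ctx_bd \<epsilon> \<Gamma>) < dim_ctx \<Gamma>"
proof -
  assume "pasting \<Gamma>"
  then have "0 \<le> dim_ctx \<Gamma>"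
    by (metis pasting_def pd_nonempty dim_ctx_nonneg)
  then show ?thesis
    by (subst dim_ctx_less_iff) (auto simp: ctx_bd_def)
qed

text \<open>
  The top-dimensional variable of a disc is its last one.  The value of \<open>UTy\<close> outside pasting
  contexts is irrelevant.
\<close>

function UTm :: "'v ctx \<Rightarrow> 'v tm" and UTy :: "'v ctx \<Rightarrow> 'v ty" where
  "UTm \<Gamma> = (if disc \<Gamma> then Var (fst (last \<Gamma>)) else Coh \<Gamma> (UTy \<Gamma>) (id_sub \<Gamma>))"
| "UTy \<Gamma> =
     (if disc \<Gamma> then snd (last \<Gamma>)
      else if pasting \<Gamma> then Arr (UTm (ctx_bd Neg \<Gamma>)) (UTy (ctx_bd Neg \<Gamma>)) (UTm (ctx_bd Pos \<Gamma>))
      else Star)"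
  by pat_completeness auto
termination
proof (relation "measure (case_sum (\<lambda>\<Gamma>. 2 * nat (dim_ctx \<Gamma> + 1) + 1) (\<lambda>\<Gamma>. 2 * nat (dim_ctx \<Gamma> + 1)))",
    goal_cases)
  case 1
  then show ?case by simp
next
  case (2 \<Gamma>)
  then show ?case by simp
next
  case (3 \<Gamma>)
  then show ?case
    using dim_ctx_bd_less[of \<Gamma> Neg] dim_ctx_nonneg[of \<Gamma>] pd_nonempty[of \<Gamma>]
    by (auto simp: pasting_def)
next
  case (4 \<Gamma>)
  then show ?case
    using dim_ctx_bd_less[of \<Gamma> Neg] dim_ctx_nonneg[of \<Gamma>] pd_nonempty[of \<Gamma>]
    by (auto simp: pasting_def)
next
  case (5 \<Gamma>)
  then show ?case
    using dim_ctx_bd_less[of \<Gamma> Pos] dim_ctx_nonneg[of \<Gamma>] pd_nonempty[of \<Gamma>]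
    by (auto simp: pasting_def)
qed

declare UTm.simps [simp del] UTy.simps [simp del]


section \<open>Insertion\<close>

text \<open>
  The value is irrelevant unless \<open>p\<close> is nonempty and the linear height of the
  inserted tree is at least \<open>length p - 1\<close>.
\<close>

fun insert_tree :: "'v tree \<Rightarrow> nat list \<Rightarrow> 'v tree \<Rightarrow> 'v tree" where
  "insert_tree (Node Sl Sb) [n] (Node Tl Tb) =
     Node (take n Sl @ Tl @ drop (n + 2) Sl) (take n Sb @ Tb @ drop (n + 1) Sb)"
| "insert_tree (Node Sl Sb) (n # m # p) (Node Tl [T']) =
     Node (take n Sl @ Tl @ drop (n + 2) Sl)
       (take n Sb @ [insert_tree (Sb ! n) (m # p) T'] @ drop (n + 1) Sb)"
| "insert_tree _ _ _ = undefined"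

text \<open>The branching path \<open>p\<close> of \<open>x\<close> is carried along instead of \<open>x\<close>.\<close>

definition insert_ctx :: "'v ctx \<Rightarrow> nat list \<Rightarrow> 'v ctx \<Rightarrow> 'v ctx" where
  "insert_ctx \<Delta> p \<Theta> = tree_ctx (insert_tree (ctx_tree \<Delta>) p (ctx_tree \<Theta>))"

text \<open>
  \<open>external_sub \<Delta> x p \<Theta> B \<kappa>\<close>: \<open>\<kappa>\<close> is the external substitution.  It is a relation because
  the sign and dimension in its defining clause are existentially quantified.  If \<open>B\<close> has the
  dimension of \<open>x\<close> (as it has in well-typed terms), there is at most one \<open>\<kappa>\<close>; if the dimension
  of \<open>B\<close> is smaller, there is none.
\<close>

definition external_sub ::
    "'v ctx \<Rightarrow> 'v \<Rightarrow> nat list \<Rightarrow> 'v ctx \<Rightarrow> 'v ty \<Rightarrow> 'v sub \<Rightarrow> bool" where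
  "external_sub \<Delta> x p \<Theta> B \<kappa> \<longleftrightarrow>
     map fst \<kappa> = map fst \<Delta> \<and>
     (\<forall>(y, t) \<in> set \<kappa>.
        if y \<in> ctx_vars (insert_ctx \<Delta> p \<Theta>) then t = Var y
        else \<exists>\<epsilon> m. tm_bd \<Delta> \<epsilon> m (Var x) = Some (Var y) \<and>
                   tm_bd (insert_ctx \<Delta> p \<Theta>) \<epsilon> m (Coh \<Theta> B (id_sub \<Theta>)) = Some t)"

definition insert_sub :: "'v ctx \<Rightarrow> nat list \<Rightarrow> 'v ctx \<Rightarrow> 'v sub \<Rightarrow> 'v sub \<Rightarrow> 'v sub option" where
  "insert_sub \<Delta> p \<Theta> \<sigma> \<tau> =
     collect_sub (map (\<lambda>(z, A). (z, if z \<in> ctx_vars \<Theta> then map_of \<tau> z else map_of \<sigma> z))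
       (insert_ctx \<Delta> p \<Theta>))"


section \<open>Reduction\<close>

inductive step_ty :: "'v ty \<Rightarrow> 'v ty \<Rightarrow> bool"
  and step_sub :: "'v sub \<Rightarrow> 'v sub \<Rightarrow> bool"
  and step_tm :: "'v tm \<Rightarrow> 'v tm \<Rightarrow> bool" where
  step_src: "step_tm s s' \<Longrightarrow> step_ty (Arr s A t) (Arr s' A t)"
| step_base: "step_ty A A' \<Longrightarrow> step_ty (Arr s A t) (Arr s A' t)"
| step_tgt: "step_tm t t' \<Longrightarrow> step_ty (Arr s A t) (Arr s A t')"
| step_entry: "step_tm t t' \<Longrightarrow> step_sub (\<sigma> @ (x, t) # \<sigma>') (\<sigma> @ (x, t') # \<sigma>')"
| step_coh_ty: "step_ty A A' \<Longrightarrow> step_tm (Coh \<Delta> A \<sigma>) (Coh \<Delta> A' \<sigma>)"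
| step_coh_sub: "step_sub \<sigma> \<sigma>' \<Longrightarrow> step_tm (Coh \<Delta> A \<sigma>) (Coh \<Delta> A \<sigma>')"
| step_insertion:
    "pasting \<Delta> \<Longrightarrow> locally_maximal \<Delta> x \<Longrightarrow>
     map_of \<sigma> x = Some (Coh \<Theta> B \<tau>) \<Longrightarrow> pasting \<Theta> \<Longrightarrow> B = UTy \<Theta> \<Longrightarrow>
     ctx_vars \<Delta> \<inter> ctx_vars \<Theta> = {} \<Longrightarrow>
     branching_path (ctx_tree \<Delta>) x p \<Longrightarrow>
     length p - 1 \<le> linear_height (ctx_tree \<Theta>) \<Longrightarrow>
     external_sub \<Delta> x p \<Theta> B \<kappa> \<Longrightarrow>
     subst_ty \<kappa> A = Some A' \<Longrightarrow>
     insert_sub \<Delta> p \<Theta> \<sigma> \<tau> = Some \<sigma>' \<Longrightarrow>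
     step_tm (Coh \<Delta> A \<sigma>) (Coh (insert_ctx \<Delta> p \<Theta>) A' \<sigma>')"

text \<open>
  Since bound names matter only up to renaming, a reduction step is a step between
  representatives.  This also provides the disjointness of \<open>\<Delta>\<close> and \<open>\<Theta>\<close> in
  \<open>step_insertion\<close>, and makes the condition \<open>B = UTy \<Theta>\<close> one up to renaming.
\<close>

definition red_ty :: "'v ty \<Rightarrow> 'v ty \<Rightarrow> bool" (infix "\<leadsto>\<^sub>t\<^sub>y" 50) where
  "A \<leadsto>\<^sub>t\<^sub>y B \<longleftrightarrow> (\<exists>A' B'. alpha_ty A A' \<and> step_ty A' B' \<and> alpha_ty B' B)"

definition red_tm :: "'v tm \<Rightarrow> 'v tm \<Rightarrow> bool" (infix "\<leadsto>\<^sub>t\<^sub>m" 50) where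
  "s \<leadsto>\<^sub>t\<^sub>m t \<longleftrightarrow> (\<exists>s' t'. alpha_tm s s' \<and> step_tm s' t' \<and> alpha_tm t' t)"

definition red_sub :: "'v sub \<Rightarrow> 'v sub \<Rightarrow> bool" (infix "\<leadsto>\<^sub>s" 50) where
  "\<sigma> \<leadsto>\<^sub>s \<tau> \<longleftrightarrow> (\<exists>\<sigma>' \<tau>'. alpha_sub \<sigma> \<sigma>' \<and> step_sub \<sigma>' \<tau>' \<and> alpha_sub \<tau>' \<tau>)"

end

theory Submission
  imports Defs "HOL-Library.Multiset"
begin

text \<open>
  A reduction step takes place at some type depth: the number of times that one has to pass from a
  coherence \<open>coh(\<Delta> : A)[\<sigma>]\<close> to its type \<open>A\<close> in order to reach the
  redex. Let \<open>cohs_tm t j\<close> count the coherences of \<open>t\<close> at type depth \<open>j\<close>.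
  An insertion at depth \<open>j\<close> merges \<open>coh(\<Theta> : B)[\<tau>]\<close> into the coherence around it,
  so it lowers the count at depth \<open>j\<close> and does not affect smaller depths
  (\<open>cohs_insert_sub\<close>, \<open>step_measures\<close>). At greater depths it can create any number of
  coherences, because the type \<open>A\<close> becomes \<open>A[\<kappa>]\<close> and \<open>\<kappa>\<close> contains
  unbiased composites. Thus the vector of counts decreases lexicographically, and there is no
  infinite descent if the depth of all terms in a reduction sequence is bounded.

  The bound is the rank. A variable of dimension \<open>d\<close> has rank \<open>d + 1\<close>, passing
  from the type of a coherence to the coherence adds one, and otherwise one takes maxima. A term of
  rank \<open>k\<close> has no coherences at depth \<open>k\<close> or beyond (\<open>cohs_imp_rank\<close>).
  The rank does not increase under reduction. The only doubtful point is again the passage from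
  \<open>A\<close> to \<open>A[\<kappa>]\<close>. There a variable of dimension \<open>m\<close> is replaced by an
  \<open>m\<close>-dimensional boundary of an unbiased coherence, which is essentially an unbiased term of
  dimension \<open>m\<close>; its type is built from unbiased terms of smaller dimension, so by induction
  its rank is at most \<open>m + 1\<close> (\<open>rank_unbiased_le\<close>, \<open>rank_external_sub\<close>). This
  induction needs that the boundaries of a pasting context are pasting contexts of dimension exactly
  one less (\<open>pasting_ctx_bd\<close>).

  Counts and rank do not see the names of bound variables (\<open>alpha_measures\<close>), so the
  argument applies to reduction up to renaming. Types and substitutions reduce inside the
  coherences \<open>coh(\<emptyset> : A)[]\<close> and \<open>coh(\<emptyset> : \<star>)[\<sigma>]\<close>, so their case
  follows from that of terms.
\<close>

section \<open>Coherence counts and rank\<close>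

text \<open>
  Coherence types live over their own bound context, so a rank depends on an assignment of numbers
  to the ambient variables. The successor matters: a variable of dimension \<open>0\<close> may be
  replaced by the coherence over the point context with type \<open>\<star>\<close>, and that
  coherence has rank \<open>1\<close>.
\<close>

definition dim_env :: "'v ctx \<Rightarrow> 'v \<Rightarrow> nat" where
  "dim_env \<Gamma> x = (case map_of \<Gamma> x of None \<Rightarrow> 0 | Some A \<Rightarrow> Suc (dim_ty A))"

text \<open>
  \<open>cohs_tm t j\<close> is the number of coherences that occur in \<open>t\<close> at type depth
  \<open>j\<close>, where entering the type \<open>A\<close> of \<open>coh(\<Gamma> : A)[\<sigma>]\<close>
  increases the depth by one and entering \<open>\<sigma>\<close> does not.
\<close>

primrec cohs_ty :: "'v ty \<Rightarrow> nat \<Rightarrow> nat" and cohs_tm :: "'v tm \<Rightarrow> nat \<Rightarrow> nat" where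
  "cohs_ty Star = (\<lambda>j. 0)"
| "cohs_ty (Arr s A t) = (\<lambda>j. cohs_tm s j + cohs_ty A j + cohs_tm t j)"
| "cohs_tm (Var x) = (\<lambda>j. 0)"
| "cohs_tm (Coh \<Gamma> A \<sigma>) = (\<lambda>j. (case j of 0 \<Rightarrow> 1 | Suc i \<Rightarrow> cohs_ty A i) +
     sum_list (map (\<lambda>(x, c). c j) (map (map_prod id cohs_tm) \<sigma>)))"

text \<open>
  The rank bounds the type depth of every coherence in a term (\<open>cohs_imp_rank\<close>). Giving
  weight to the variables is what makes it stable under insertion: a variable pays in advance for
  the unbiased coherence that an external substitution may put in its place.
\<close>

primrec rank_ty :: "'v ty \<Rightarrow> ('v \<Rightarrow> nat) \<Rightarrow> nat" and rank_tm :: "'v tm \<Rightarrow> ('v \<Rightarrow> nat) \<Rightarrow> nat" where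
  "rank_ty Star = (\<lambda>e. 0)"
| "rank_ty (Arr s A t) = (\<lambda>e. max (rank_tm s e) (max (rank_ty A e) (rank_tm t e)))"
| "rank_tm (Var x) = (\<lambda>e. e x)"
| "rank_tm (Coh \<Gamma> A \<sigma>) = (\<lambda>e. Max (insert (Suc (rank_ty A (dim_env \<Gamma>)))
     ((\<lambda>(x, r). r e) ` set (map (map_prod id rank_tm) \<sigma>))))"

abbreviation cohs_sub :: "'v sub \<Rightarrow> nat \<Rightarrow> nat" where
  "cohs_sub \<sigma> j \<equiv> (\<Sum>t\<leftarrow>map snd \<sigma>. cohs_tm t j)"

lemma cohs_Coh: "cohs_tm (Coh \<Gamma> A \<sigma>) j = (case j of 0 \<Rightarrow> 1 | Suc i \<Rightarrow> cohs_ty A i) + cohs_sub \<sigma> j"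
  by (simp add: o_def case_prod_beta)

lemma rank_Coh:
  "rank_tm (Coh \<Gamma> A \<sigma>) e =
     Max (insert (Suc (rank_ty A (dim_env \<Gamma>))) ((\<lambda>p. rank_tm (snd p) e) ` set \<sigma>))"
  by (simp add: image_image case_prod_beta)

lemma rank_Coh_le_iff:
  "rank_tm (Coh \<Gamma> A \<sigma>) e \<le> k \<longleftrightarrow>
     Suc (rank_ty A (dim_env \<Gamma>)) \<le> k \<and> (\<forall>t \<in> snd ` set \<sigma>. rank_tm t e \<le> k)"
  by (auto simp: case_prod_beta)

declare cohs_tm.simps(2) [simp del] rank_tm.simps(2) [simp del]

lemma cohs_imp_rank:
  fixes A :: "'v ty" and t :: "'v tm"
  shows "0 < cohs_ty A j \<Longrightarrow> j < rank_ty A e"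
  "0 < cohs_tm t j \<Longrightarrow> j < rank_tm t e"
proof (induction A and t arbitrary: j e and j e rule: ty.induct tm.induct)
  case (Coh \<Gamma> A \<sigma>)
  let ?k = "rank_tm (Coh \<Gamma> A \<sigma>) e"
  have k: "Suc (rank_ty A (dim_env \<Gamma>)) \<le> ?k" "\<And>t. t \<in> snd ` set \<sigma> \<Longrightarrow> rank_tm t e \<le> ?k"
    using rank_Coh_le_iff[of \<Gamma> A \<sigma> e ?k] by auto
  show ?case
  proof (cases "0 < cohs_sub \<sigma> j")
    case True
    then obtain x t where t: "(x, t) \<in> set \<sigma>" "0 < cohs_tm t j"
      by (auto simp flip: neq0_conv)
    then have "j < rank_tm t e"
      using Coh.IH(3)[of "(x, t)" t] by auto
    then show ?thesis
      using k(2)[of t] t(1) by force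
  next
    case False
    then have "0 < (case j of 0 \<Rightarrow> 1 | Suc i \<Rightarrow> cohs_ty A i)"
      using Coh.prems unfolding cohs_Coh by linarith
    then have "j \<le> rank_ty A (dim_env \<Gamma>)"
      using Coh.IH(2) by (cases j) (auto simp: Suc_le_eq)
    then show ?thesis
      using k(1) by linarith
  qed
qed (auto simp: less_max_iff_disj)

section \<open>Invariance under renaming of bound contexts\<close>

lemma rank_Coh_cong:
  assumes "rank_ty A (dim_env \<Gamma>) = rank_ty A' (dim_env \<Gamma>')"
    and "list_all2 (\<lambda>(_, t) (_, t'). rank_tm t e = rank_tm t' e) \<sigma> \<sigma>'"
  shows "rank_tm (Coh \<Gamma> A \<sigma>) e = rank_tm (Coh \<Gamma>' A' \<sigma>') e"
proof -
  have "(\<lambda>p. rank_tm (snd p) e) ` set \<sigma> = (\<lambda>p. rank_tm (snd p) e) ` set \<sigma>'"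
    using assms(2) by (induction rule: list_all2_induct) auto
  then show ?thesis
    using assms(1) by (simp add: rank_Coh)
qed

lemma rename_measures:
  fixes A :: "'v ty" and t :: "'v tm"
  shows "dim_ty (rename_ty \<pi> A) = dim_ty A \<and> cohs_ty (rename_ty \<pi> A) = cohs_ty A \<and>
     (\<forall>e. rank_ty (rename_ty \<pi> A) e = rank_ty A (e \<circ> \<pi>))"
  "cohs_tm (rename_tm \<pi> t) = cohs_tm t \<and> (\<forall>e. rank_tm (rename_tm \<pi> t) e = rank_tm t (e \<circ> \<pi>))"
proof (induction A and t rule: ty.induct tm.induct)
  case (Coh \<Gamma> A \<sigma>)
  have IH: "cohs_tm (rename_tm \<pi> t) = cohs_tm t" "rank_tm (rename_tm \<pi> t) e = rank_tm t (e \<circ> \<pi>)"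
    if "(x, t) \<in> set \<sigma>" for x t e
    using Coh.IH(3)[OF that, of t] by (auto simp: o_def)
  have "cohs_sub (map (map_prod id (rename_tm \<pi>)) \<sigma>) j = cohs_sub \<sigma> j" for j
    using IH(1) by (auto simp: o_def intro!: arg_cong[where f = sum_list])
  moreover have "rank_tm (rename_tm \<pi> (Coh \<Gamma> A \<sigma>)) e = rank_tm (Coh \<Gamma> A \<sigma>) (e \<circ> \<pi>)" for e
  proof -
    have "(\<lambda>p. rank_tm (snd p) e) ` set (map (map_prod id (rename_tm \<pi>)) \<sigma>) =
        (\<lambda>p. rank_tm (snd p) (e \<circ> \<pi>)) ` set \<sigma>"
      unfolding set_map image_image by (rule image_cong) (auto simp: IH(2))
    then show ?thesis
      by (simp add: rank_Coh)
  qed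
  ultimately show ?case
    by (auto simp: cohs_Coh fun_eq_iff o_def)
qed auto

lemma dim_env_rename:
  assumes "bij \<pi>"
  shows "dim_env (map (map_prod \<pi> (rename_ty \<pi>)) \<Gamma>) \<circ> \<pi> = dim_env \<Gamma>"
proof -
  have "map_of (map (map_prod \<pi> (rename_ty \<pi>)) \<Gamma>) (\<pi> z) = map_option (rename_ty \<pi>) (map_of \<Gamma> z)" for z
    using bij_is_inj[OF assms] by (induction \<Gamma>) (auto simp: inj_eq)
  then show ?thesis
    by (auto simp: fun_eq_iff dim_env_def rename_measures split: option.split)
qed

lemma alpha_measures:
  fixes A B :: "'v ty" and s t :: "'v tm"
  shows "alpha_ty A B \<Longrightarrow> dim_ty A = dim_ty B \<and> cohs_ty A = cohs_ty B \<and> rank_ty A = rank_ty B"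
  "alpha_tm s t \<Longrightarrow> cohs_tm s = cohs_tm t \<and> rank_tm s = rank_tm t"
proof (induction rule: alpha_ty_alpha_tm.inducts)
  case (alpha_coh_ctx B B' \<Gamma> x \<Gamma>' A \<sigma>)
  from alpha_coh_ctx have env: "dim_env (\<Gamma> @ (x, B) # \<Gamma>') = dim_env (\<Gamma> @ (x, B') # \<Gamma>')"
    by (auto simp: dim_env_def fun_eq_iff map_add_def split: option.split)
  show ?case
    unfolding fun_eq_iff cohs_Coh rank_Coh env by simp
next
  case (alpha_coh_ty A A' \<Gamma> \<sigma>)
  then show ?case
    unfolding fun_eq_iff cohs_Coh rank_Coh by (simp cong: nat.case_cong)
next
  case (alpha_coh_sub t t' \<Gamma> A \<sigma> x \<sigma>')
  then show ?case
    by (auto simp: fun_eq_iff cohs_Coh rank_Coh)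
next
  case (alpha_rename \<pi> \<Gamma> A \<sigma>)
  have "rank_ty A (dim_env \<Gamma>) = rank_ty (rename_ty \<pi> A) (dim_env (map (map_prod \<pi> (rename_ty \<pi>)) \<Gamma>))"
    using dim_env_rename[OF alpha_rename(1), of \<Gamma>] by (simp add: rename_measures)
  then have "rank_tm (Coh \<Gamma> A \<sigma>) e =
    rank_tm (Coh (map (map_prod \<pi> (rename_ty \<pi>)) \<Gamma>) (rename_ty \<pi> A) (map (map_prod \<pi> id) \<sigma>)) e" for e
    by (intro rank_Coh_cong) (auto simp: list_all2_conv_all_nth case_prod_beta)
  then show ?case
    by (auto simp: fun_eq_iff cohs_Coh rename_measures o_def split: nat.split)
qed auto

section \<open>Rank under substitution\<close>

lemma collect_sub_SomeD:
  "collect_sub xs = Some \<sigma> \<Longrightarrow> xs = map (map_prod id Some) \<sigma>"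
proof (induction xs arbitrary: \<sigma>)
  case (Cons p xs)
  then show ?case by (cases p) (auto simp: collect_sub_def split: option.splits)
qed (simp add: collect_sub_def)

text \<open>
  The bound type of a coherence contributes equally on both sides, as substitution leaves it alone;
  only the leaves that are variables of the ambient context change.
\<close>

lemma rank_subst_le:
  assumes "\<And>y u. map_of \<kappa> y = Some u \<Longrightarrow> rank_tm u e' \<le> e y"
  shows "subst_ty \<kappa> A = Some A' \<Longrightarrow> rank_ty A' e' \<le> rank_ty A e"
    and "subst_tm \<kappa> t = Some t' \<Longrightarrow> rank_tm t' e' \<le> rank_tm t e"
proof (induction A and t arbitrary: A' and t' rule: ty.induct tm.induct)
  case (Arr s A t)
  then show ?case by (fastforce split: Option.bind_splits)
next
  case (Var x)
  then show ?case using assms by auto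
next
  case (Coh \<Gamma> A \<sigma>)
  then obtain \<sigma>' where t': "t' = Coh \<Gamma> A \<sigma>'"
    and \<sigma>': "map (map_prod id (subst_tm \<kappa>)) \<sigma> = map (map_prod id Some) \<sigma>'"
    using collect_sub_SomeD by fastforce
  have k: "Suc (rank_ty A (dim_env \<Gamma>)) \<le> rank_tm (Coh \<Gamma> A \<sigma>) e"
    "\<And>t. t \<in> snd ` set \<sigma> \<Longrightarrow> rank_tm t e \<le> rank_tm (Coh \<Gamma> A \<sigma>) e"
    using rank_Coh_le_iff[of \<Gamma> A \<sigma> e "rank_tm (Coh \<Gamma> A \<sigma>) e"] by auto
  have "rank_tm u e' \<le> rank_tm (Coh \<Gamma> A \<sigma>) e" if "(x, u) \<in> set \<sigma>'" for x u
  proof -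
    have "(x, Some u) \<in> set (map (map_prod id (subst_tm \<kappa>)) \<sigma>)"
      unfolding \<sigma>' using that by force
    then obtain t where t: "(x, t) \<in> set \<sigma>" "subst_tm \<kappa> t = Some u"
      by auto
    then have "rank_tm u e' \<le> rank_tm t e"
      using Coh.IH(3)[of "(x, t)" t] by auto
    then show ?thesis
      using k(2)[of t] t(1) by force
  qed
  then show ?case
    unfolding t' rank_Coh_le_iff using k(1) by auto
qed auto

section \<open>Pasting contexts as trees\<close>

text \<open>
  A label at distance \<open>d\<close> from the root of a tree is a variable of dimension
  \<open>d\<close> of the associated context. Recording labels with their distances as a multiset
  keeps both the multiplicities, which show that the variables are distinct, and the dimensions.
\<close>

fun label_levels :: "nat \<Rightarrow> 'v tree \<Rightarrow> ('v \<times> nat) multiset" where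
  "label_levels d (Node ls ts) =
     mset (map (\<lambda>l. (l, d)) ls) + sum_list (map (label_levels (Suc d)) ts)"

definition ctx_levels :: "nat \<Rightarrow> 'v ctx \<Rightarrow> ('v \<times> nat) multiset" where
  "ctx_levels d \<Gamma> = mset (map (\<lambda>(x, A). (x, d + dim_ty A)) \<Gamma>)"

lemma dim_suspend_ty [simp]: "dim_ty (suspend_ty l l' A) = Suc (dim_ty A)"
  by (induction A rule: ty.induct[where ?P2.0 = "\<lambda>_. True"]) auto

lemma ctx_levels_simps [simp]:
  "ctx_levels d [] = {#}"
  "ctx_levels d ((x, A) # \<Gamma>) = add_mset (x, d + dim_ty A) (ctx_levels d \<Gamma>)"
  "ctx_levels d (\<Gamma> @ \<Delta>) = ctx_levels d \<Gamma> + ctx_levels d \<Delta>"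
  "ctx_levels d (suspend_ctx l l' \<Gamma>) = ctx_levels (Suc d) \<Gamma>"
  by (auto simp: ctx_levels_def suspend_ctx_def o_def case_prod_unfold simp flip: mset_map)

text \<open>
  For an arbitrary tree, \<open>tree_ctx\<close> may drop labels or branches but invents none. For
  the context of an inserted tree such an upper bound is all that matters.
\<close>

lemma ctx_levels_tree_ctx_subset:
  fixes T :: "'v tree" and l :: 'v
  shows "ctx_levels d (tree_ctx T) \<subseteq># label_levels d T"
    and "ctx_levels d (branches_ctx l ls ts) \<subseteq>#
       mset (map (\<lambda>l. (l, d)) ls) + sum_list (map (label_levels (Suc d)) ts)"
proof (induction T and l ls ts arbitrary: d and d rule: tree_ctx_branches_ctx.induct)
  case (3 l l' ls t ts)
  then show ?case
    using subset_mset.add_mono[OF 3(1)[of "Suc d"] 3(2)[of d]] by (simp add: ac_simps)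
qed auto

lemma ctx_levels_tree_ctx:
  fixes T :: "'v tree" and l :: 'v
  shows "tree_shape T \<Longrightarrow> ctx_levels d (tree_ctx T) = label_levels d T"
    and "length ls = length ts \<Longrightarrow> \<forall>t \<in> set ts. tree_shape t \<Longrightarrow> ctx_levels d (branches_ctx l ls ts) =
       mset (map (\<lambda>l. (l, d)) ls) + sum_list (map (label_levels (Suc d)) ts)"
  by (induction T and l ls ts arbitrary: d and d rule: tree_ctx_branches_ctx.induct) auto

lemma fst_label_levels: "image_mset fst (label_levels d T) = mset (labels T)"
proof (induction d T rule: label_levels.induct)
  case (1 d ls ts)
  then have "image_mset fst (sum_list (map (label_levels (Suc d)) ts)) = mset (concat (map labels ts))"
    by (induction ts) auto
  then show ?case
    by (simp add: o_def image_mset.compositionality)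
qed

lemma fst_ctx_levels: "image_mset fst (ctx_levels d \<Gamma>) = mset (map fst \<Gamma>)"
  by (simp add: ctx_levels_def image_mset.compositionality o_def case_prod_beta)

text \<open>
  \<open>rightmost T x A\<close> says that \<open>x\<close> is the last label of some node on the
  rightmost spine of \<open>T\<close>, and that \<open>A\<close> is its type in the context of
  \<open>T\<close>. These are the variables at which a pasting context can be extended: the judgement
  \<open>\<Gamma> \<turnstile>\<^sub>p\<^sub>d x : A\<close> is a walk along this spine.
\<close>

inductive rightmost :: "'v tree \<Rightarrow> 'v \<Rightarrow> 'v ty \<Rightarrow> bool" where
  rightmost_root: "rightmost (Node (ls @ [l]) ts) l Star"
| rightmost_branch: "rightmost t x A \<Longrightarrow>
    rightmost (Node (ls @ [l, l']) (ts @ [t])) x (suspend_ty l l' A)"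

lemma branches_ctx_snoc:
  "length ls = length ts \<Longrightarrow> branches_ctx l (ls @ [l']) (ts @ [t]) =
     branches_ctx l ls ts @ (l', Star) # suspend_ctx (last (l # ls)) l' (tree_ctx t)"
  by (induction ls ts arbitrary: l rule: list_induct2) auto

lemma tree_ctx_snoc:
  "length ls = length ts \<Longrightarrow> tree_ctx (Node (ls @ [l, l']) (ts @ [t])) =
     tree_ctx (Node (ls @ [l]) ts) @ (l', Star) # suspend_ctx l l' (tree_ctx t)"
  using branches_ctx_snoc[of "tl (ls @ [l])" ts "hd (ls @ [l])" l' t]
  by (cases ls) auto

text \<open>
  Gluing a new cell \<open>f : x \<rightarrow> y\<close> appends the label \<open>y\<close> to the node of
  \<open>x\<close>, together with a new last branch whose only label is \<open>f\<close>.
\<close>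

lemma rightmost_extend:
  assumes "rightmost T x A" "tree_shape T"
  shows "\<exists>T'. tree_shape T' \<and>
    tree_ctx T' = tree_ctx T @ [(y, A), (f, Arr (Var x) A (Var y))] \<and>
    rightmost T' f (Arr (Var x) A (Var y))"
  using assms
proof (induction rule: rightmost.induct)
  case (rightmost_root ls l ts)
  have "rightmost (Node ([] @ [f]) []) f Star"
    by (rule rightmost.intros)
  then have "rightmost (Node (ls @ [l, y]) (ts @ [Node [f] []])) f (Arr (Var l) Star (Var y))"
    using rightmost_branch[of "Node [f] []" f Star] by simp
  then show ?case
    using rightmost_root tree_ctx_snoc[of ls ts l y "Node [f] []"]
    by (intro exI[of _ "Node (ls @ [l, y]) (ts @ [Node [f] []])"]) (auto simp: suspend_ctx_def)
next
  case (rightmost_branch t x A ls l l' ts)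
  then obtain T' where T': "tree_shape T'"
    "tree_ctx T' = tree_ctx t @ [(y, A), (f, Arr (Var x) A (Var y))]"
    "rightmost T' f (Arr (Var x) A (Var y))"
    by auto
  then show ?case
    using rightmost_branch.prems rightmost.rightmost_branch[OF T'(3), of ls l l' ts]
      tree_ctx_snoc[of ls ts l l']
    by (intro exI[of _ "Node (ls @ [l, l']) (ts @ [T'])"]) (auto simp: suspend_ctx_def)
qed

text \<open>
  If \<open>f\<close> sits in the last branch of a node, then its target is the last label of that node:
  the type of \<open>f\<close> was obtained by suspending \<open>\<star>\<close> between the last two labels.
\<close>

lemma rightmost_down:
  "rightmost T f B \<Longrightarrow> B = Arr (Var x) A (Var y) \<Longrightarrow> rightmost T y A"
proof (induction arbitrary: A rule: rightmost.induct)
  case (rightmost_branch t f A0 ls l l' ts)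
  show ?case
  proof (cases A0)
    case Star
    then show ?thesis
      using rightmost_branch.prems rightmost_root[of "ls @ [l]" l'] by auto
  next
    case (Arr s A1 u)
    then show ?thesis
      using rightmost_branch by (auto intro: rightmost.intros)
  qed
qed auto

lemma pd_imp_tree:
  "pd \<Gamma> x A \<Longrightarrow> \<exists>T. tree_shape T \<and> tree_ctx T = \<Gamma> \<and> rightmost T x A"
proof (induction rule: pd.induct)
  case (pd_point x)
  show ?case
    using rightmost_root[of "[]" x "[]"] by (intro exI[of _ "Node [x] []"]) auto
next
  case (pd_extend \<Gamma> x A y f)
  then show ?case
    using rightmost_extend by metis
next
  case (pd_down \<Gamma> f x A y)
  then show ?case
    using rightmost_down by metis
qed

lemma pd_distinct: "pd \<Gamma> x A \<Longrightarrow> distinct (map fst \<Gamma>)"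
  by (induction rule: pd.induct) (auto simp: ctx_vars_def)

text \<open>
  Every type that occurs in a pasting context is a tower of arrows between parallel variables of that
  context. This is what makes \<open>ty_bd\<close> return variables of the right dimension.
\<close>

inductive scoped :: "'v ctx \<Rightarrow> 'v ty \<Rightarrow> bool" for \<Gamma> where
  scoped_Star: "scoped \<Gamma> Star"
| scoped_Arr: "scoped \<Gamma> A \<Longrightarrow> (x, A) \<in> set \<Gamma> \<Longrightarrow> (y, A) \<in> set \<Gamma> \<Longrightarrow>
    scoped \<Gamma> (Arr (Var x) A (Var y))"

inductive_cases scoped_ArrE: "scoped \<Gamma> (Arr s A t)"

lemma scoped_mono: "scoped \<Gamma> A \<Longrightarrow> set \<Gamma> \<subseteq> set \<Gamma>' \<Longrightarrow> scoped \<Gamma>' A"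
  by (induction rule: scoped.induct) (auto intro: scoped.intros)

lemma scoped_ty_bd:
  "scoped \<Gamma> A \<Longrightarrow> ty_bd \<epsilon> m A = Some t \<Longrightarrow> \<exists>y B. t = Var y \<and> (y, B) \<in> set \<Gamma> \<and> dim_ty B = m"
  by (induction rule: scoped.induct) (auto split: if_splits sign.splits)

lemma pd_scoped:
  "pd \<Gamma> x A \<Longrightarrow> (x, A) \<in> set \<Gamma> \<and> (\<forall>(z, C) \<in> set \<Gamma>. scoped \<Gamma> C)"
proof (induction rule: pd.induct)
  case (pd_extend \<Gamma> x A y f)
  let ?\<Gamma> = "\<Gamma> @ [(y, A), (f, Arr (Var x) A (Var y))]"
  have old: "scoped ?\<Gamma> C" if "(z, C) \<in> set \<Gamma>" for z C
    using that pd_extend.IH scoped_mono[of \<Gamma> C ?\<Gamma>] by auto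
  moreover have "scoped ?\<Gamma> (Arr (Var x) A (Var y))"
    using old pd_extend.IH by (intro scoped_Arr) auto
  ultimately show ?case
    using pd_extend.IH by auto
next
  case (pd_down \<Gamma> f x A y)
  then show ?case
    by (auto elim: scoped_ArrE)
qed (auto intro: scoped.intros)

text \<open>
  \<open>ctx_tree\<close> is an inverse chosen on the range of \<open>tree_ctx\<close>, so its properties
  hold once every pasting context is known to come from a tree.
\<close>

lemma pasting_tree:
  assumes "pasting \<Gamma>"
  shows "wf_tree (ctx_tree \<Gamma>)" "tree_ctx (ctx_tree \<Gamma>) = \<Gamma>"
proof -
  obtain x where pd: "pd \<Gamma> x Star"
    using assms unfolding pasting_def by auto
  then obtain T where T: "tree_shape T" "tree_ctx T = \<Gamma>"
    using pd_imp_tree[OF pd] by auto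
  then have "mset (labels T) = mset (map fst \<Gamma>)"
    using ctx_levels_tree_ctx(1)[OF T(1), of 0] by (metis fst_ctx_levels fst_label_levels)
  then have "wf_tree T"
    using T(1) pd_distinct[OF pd] mset_eq_imp_distinct_iff[of "labels T" "map fst \<Gamma>"]
    by (simp add: wf_tree_def)
  then have "\<Gamma> \<in> tree_ctx ` {T. wf_tree T}"
    using T(2) by auto
  then show "wf_tree (ctx_tree \<Gamma>)" "tree_ctx (ctx_tree \<Gamma>) = \<Gamma>"
    using inv_into_into[of \<Gamma> tree_ctx "{T. wf_tree T}"] f_inv_into_f[of \<Gamma> tree_ctx "{T. wf_tree T}"]
    by (simp_all add: ctx_tree_def)
qed

section \<open>Variables of an inserted tree\<close>

lemma branching_path_nonempty: "branching_path S x p \<Longrightarrow> p \<noteq> []"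
  by (induction rule: branching_path.induct) auto

text \<open>
  What an insertion below the \<open>n\<close>-th branch keeps, and what it may discard: the two labels
  around the branch, and the branch itself.
\<close>

lemma label_levels_split:
  assumes "n < length ts" "length ls = Suc (length ts)"
  shows "label_levels d (Node ls ts) =
    label_levels d (Node (take n ls @ drop (n + 2) ls) (take n ts @ drop (n + 1) ts))
    + {#(ls ! n, d), (ls ! Suc n, d)#} + label_levels (Suc d) (ts ! n)"
proof -
  have "ls = take n ls @ ls ! n # ls ! Suc n # drop (n + 2) ls"
    using assms by (simp add: Cons_nth_drop_Suc)
  moreover have "ts = take n ts @ ts ! n # drop (n + 1) ts"
    using assms by (simp add: Cons_nth_drop_Suc)
  ultimately have "label_levels d (Node ls ts) = label_levels d
      (Node (take n ls @ ls ! n # ls ! Suc n # drop (n + 2) ls) (take n ts @ ts ! n # drop (n + 1) ts))"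
    by simp
  then show ?thesis
    by simp
qed

lemma add_mset_subset_in_context:
  assumes "add_mset a I \<subseteq># L + T"
  shows "add_mset a (C + M + I) \<subseteq># (C + E + L) + (M + T)"
proof -
  have "(C + M) + add_mset a I \<subseteq># (C + M) + (L + T)"
    using assms by simp
  also have "\<dots> \<subseteq># (C + M) + (L + T) + E"
    by (rule mset_subset_eq_add_left)
  finally show ?thesis
    by (simp add: ac_simps)
qed

text \<open>
  Insertion only rearranges labels, at unchanged distance from the root: the trees are aligned along
  the path, so a label of \<open>T\<close> ends up at the level at which it started. The labels around
  the path are replaced by those of \<open>T\<close>, and the linear branch that contains
  \<open>x\<close> disappears as a whole, so there is room for one copy of \<open>x\<close>.
\<close>

lemma label_levels_insert_tree:
  assumes "branching_path S x p" "tree_shape S" "x \<in> set (labels S)"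
    "length p - 1 \<le> linear_height T"
  shows "\<exists>k. add_mset (x, k) (label_levels d (insert_tree S p T)) \<subseteq># label_levels d S + label_levels d T"
  using assms
proof (induction arbitrary: T d rule: branching_path.induct)
  case (1 ls x)
  then have "ls = [x]"
    by (cases ls) auto
  then show ?case
    by (cases T) auto
next
  case (2 n ts x ls)
  obtain Tl Tb where T: "T = Node Tl Tb"
    by (cases T)
  have "x \<in># mset (labels (ts ! n))"
    using 2 by simp
  then obtain k where k: "(x, k) \<in># label_levels (Suc d) (ts ! n)"
    unfolding fst_label_levels[of "Suc d", symmetric] by auto
  let ?C = "label_levels d (Node (take n ls @ drop (n + 2) ls) (take n ts @ drop (n + 1) ts))"
  have split: "label_levels d (Node ls ts) =
      ?C + {#(ls ! n, d), (ls ! Suc n, d)#} + label_levels (Suc d) (ts ! n)"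
    using 2 by (intro label_levels_split) auto
  have ins: "label_levels d (insert_tree (Node ls ts) [n] T) = ?C + label_levels d T + {#}"
    by (simp add: T)
  have "add_mset (x, k) {#} \<subseteq># label_levels (Suc d) (ts ! n) + {#}"
    using k by simp
  from add_mset_subset_in_context[OF this, of ?C "label_levels d T" "{#(ls ! n, d), (ls ! Suc n, d)#}"]
  show ?case
    unfolding split ins add_0_right by (rule exI)
next
  case (3 n ts x p ls)
  then obtain m p' where p: "p = m # p'"
    using branching_path_nonempty by (metis list.exhaust)
  obtain Tl T' where T: "T = Node Tl [T']"
    using 3(8) p by (cases T rule: linear_height.cases) auto
  have "tree_shape (ts ! n)" "length p - 1 \<le> linear_height T'"
    using 3(1,6,8) by (auto simp: p T)
  then obtain k where "add_mset (x, k) (label_levels (Suc d) (insert_tree (ts ! n) p T')) \<subseteq>#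
      label_levels (Suc d) (ts ! n) + label_levels (Suc d) T'"
    using 3(5)[of T' "Suc d"] 3(2) by auto
  note k = add_mset_subset_in_context[OF this]
  let ?C = "label_levels d (Node (take n ls @ drop (n + 2) ls) (take n ts @ drop (n + 1) ts))"
  have split: "label_levels d (Node ls ts) =
      ?C + {#(ls ! n, d), (ls ! Suc n, d)#} + label_levels (Suc d) (ts ! n)"
    using 3 by (intro label_levels_split) auto
  have ins: "label_levels d (insert_tree (Node ls ts) (n # p) T) =
      ?C + mset (map (\<lambda>l. (l, d)) Tl) + label_levels (Suc d) (insert_tree (ts ! n) p T')"
    by (simp add: T p)
  have T_levels: "label_levels d T = mset (map (\<lambda>l. (l, d)) Tl) + label_levels (Suc d) T'"
    by (simp add: T)
  show ?case
    unfolding split ins T_levels using k by blast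
qed

lemma insert_ctx_levels:
  assumes "pasting \<Delta>" "pasting \<Theta>" "x \<in> ctx_vars \<Delta>" "branching_path (ctx_tree \<Delta>) x p"
    "length p - 1 \<le> linear_height (ctx_tree \<Theta>)"
  shows "\<exists>k. add_mset (x, k) (ctx_levels 0 (insert_ctx \<Delta> p \<Theta>)) \<subseteq># ctx_levels 0 \<Delta> + ctx_levels 0 \<Theta>"
proof -
  have shape: "tree_shape (ctx_tree \<Delta>)" "tree_shape (ctx_tree \<Theta>)"
    using assms pasting_tree(1) unfolding wf_tree_def by auto
  have levels: "label_levels 0 (ctx_tree \<Delta>) = ctx_levels 0 \<Delta>" "label_levels 0 (ctx_tree \<Theta>) = ctx_levels 0 \<Theta>"
    using assms ctx_levels_tree_ctx(1)[of _ 0] shape pasting_tree(2) by metis+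
  have "mset (labels (ctx_tree \<Delta>)) = mset (map fst \<Delta>)"
    by (metis levels(1) fst_ctx_levels fst_label_levels)
  then have "x \<in> set (labels (ctx_tree \<Delta>))"
    using assms(3) by (metis ctx_vars_def set_map set_mset_mset)
  from label_levels_insert_tree[OF assms(4) shape(1) this assms(5), of 0]
  obtain k where "add_mset (x, k) (label_levels 0 (insert_tree (ctx_tree \<Delta>) p (ctx_tree \<Theta>)))
      \<subseteq># ctx_levels 0 \<Delta> + ctx_levels 0 \<Theta>"
    unfolding levels by auto
  moreover have "add_mset (x, k) (ctx_levels 0 (insert_ctx \<Delta> p \<Theta>)) \<subseteq>#
      add_mset (x, k) (label_levels 0 (insert_tree (ctx_tree \<Delta>) p (ctx_tree \<Theta>)))"
    unfolding insert_ctx_def by (simp add: ctx_levels_tree_ctx_subset(1))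
  ultimately show ?thesis
    using subset_mset.order_trans by blast
qed

section \<open>Boundaries of pasting contexts\<close>

lemma pd_scopedD:
  assumes "pd \<Gamma> x A" "(z, C) \<in> set \<Gamma>" "ty_bd \<epsilon> m C = Some t"
  shows "\<exists>y B. t = Var y \<and> (y, B) \<in> set \<Gamma> \<and> dim_ty B = m"
  using pd_scoped[OF assms(1)] assms(2,3) scoped_ty_bd by blast

text \<open>
  The condition that removes a variable of codimension one in \<open>ctx_bd\<close>, with the dimension
  of the context replaced by an arbitrary \<open>n + 1\<close>. Only with \<open>n\<close> fixed while the
  context grows can boundaries be treated by induction on pasting contexts.
\<close>

definition is_cut :: "sign \<Rightarrow> nat \<Rightarrow> 'v ctx \<Rightarrow> 'v \<Rightarrow> bool" where
  "is_cut \<epsilon> n \<Gamma> y \<longleftrightarrow> (\<exists>(f, C) \<in> set \<Gamma>. dim_ty C = Suc n \<and> ty_bd (opposite \<epsilon>) n C = Some (Var y))"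

definition truncate :: "sign \<Rightarrow> nat \<Rightarrow> 'v ctx \<Rightarrow> 'v ctx" where
  "truncate \<epsilon> n \<Gamma> = filter (\<lambda>(y, B). dim_ty B \<le> n \<and> \<not> (dim_ty B = n \<and> is_cut \<epsilon> n \<Gamma> y)) \<Gamma>"

lemma ctx_bd_eq_truncate: "dim_ctx \<Gamma> = int (Suc n) \<Longrightarrow> ctx_bd \<epsilon> \<Gamma> = truncate \<epsilon> n \<Gamma>"
  unfolding ctx_bd_def truncate_def is_cut_def by (intro filter_cong) (auto simp: case_prod_unfold)

lemma set_truncate: "set (truncate \<epsilon> n \<Gamma>) \<subseteq> set \<Gamma>"
  by (auto simp: truncate_def)

lemma cut_in_ctx: "pd \<Gamma> x A \<Longrightarrow> is_cut \<epsilon> n \<Gamma> z \<Longrightarrow> z \<in> ctx_vars \<Gamma>"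
  unfolding is_cut_def ctx_vars_def by (force dest: pd_scopedD)

lemma cut_extend:
  assumes "pd \<Gamma> x A"
  shows "is_cut \<epsilon> n (\<Gamma> @ [(y, A), (f, Arr (Var x) A (Var y))]) z \<longleftrightarrow>
    is_cut \<epsilon> n \<Gamma> z \<or> dim_ty A = n \<and> z = (case \<epsilon> of Neg \<Rightarrow> y | Pos \<Rightarrow> x)"
proof -
  have "(x, A) \<in> set \<Gamma>"
    using pd_scoped[OF assms] by blast
  then show ?thesis
    by (cases \<epsilon>) (auto simp: is_cut_def)
qed

text \<open>
  The four ways in which gluing on a cell \<open>f : x \<rightarrow> y\<close> affects a truncation. In
  the critical dimension, \<open>f\<close> is cut off; the source truncation then stays the same, while
  the target truncation has \<open>y\<close> in place of \<open>x\<close>.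
\<close>

lemma truncate_extend:
  assumes "pd \<Gamma> x A" "y \<notin> ctx_vars \<Gamma>" "f \<notin> ctx_vars \<Gamma>" "y \<noteq> f"
  defines "\<Gamma>' \<equiv> \<Gamma> @ [(y, A), (f, Arr (Var x) A (Var y))]"
  shows "dim_ty A < n \<Longrightarrow> truncate \<epsilon> n \<Gamma>' = truncate \<epsilon> n \<Gamma> @ [(y, A), (f, Arr (Var x) A (Var y))]"
    and "dim_ty A = n \<Longrightarrow> truncate Neg n \<Gamma>' = truncate Neg n \<Gamma>"
    and "dim_ty A = n \<Longrightarrow> truncate Pos n \<Gamma>' = filter (\<lambda>(z, B). z \<noteq> x) (truncate Pos n \<Gamma>) @ [(y, A)]"
    and "n < dim_ty A \<Longrightarrow> truncate \<epsilon> n \<Gamma>' = truncate \<epsilon> n \<Gamma>"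
proof -
  have xA: "(x, A) \<in> set \<Gamma>"
    using pd_scoped[OF assms(1)] by blast
  then have x: "x \<in> ctx_vars \<Gamma>" "x \<noteq> y" "x \<noteq> f"
    using assms(2,3) by (force simp: ctx_vars_def)+
  have B: "B = A" if "(x, B) \<in> set \<Gamma>" for B
    using that xA pd_distinct[OF assms(1)] by (metis map_of_eq_Some_iff option.inject)
  have old: "\<not> is_cut \<epsilon> n \<Gamma> y" "\<not> is_cut \<epsilon> n \<Gamma> f" for \<epsilon>
    using cut_in_ctx[OF assms(1)] assms(2,3) by blast+
  have y: "z \<noteq> y" if "(z, B) \<in> set \<Gamma>" for z B
    using that assms(2) by (auto simp: ctx_vars_def image_iff)
  note cut = cut_extend[OF assms(1), of _ n y f, folded \<Gamma>'_def]
  show "dim_ty A < n \<Longrightarrow> truncate \<epsilon> n \<Gamma>' = truncate \<epsilon> n \<Gamma> @ [(y, A), (f, Arr (Var x) A (Var y))]"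
    unfolding truncate_def cut by (simp add: \<Gamma>'_def old)
  show "dim_ty A = n \<Longrightarrow> truncate Neg n \<Gamma>' = truncate Neg n \<Gamma>"
    unfolding truncate_def cut using y by (auto simp: \<Gamma>'_def old intro!: filter_cong)
  show "dim_ty A = n \<Longrightarrow> truncate Pos n \<Gamma>' = filter (\<lambda>(z, B). z \<noteq> x) (truncate Pos n \<Gamma>) @ [(y, A)]"
    unfolding truncate_def cut using x B by (auto simp: \<Gamma>'_def old intro!: filter_cong)
  show "n < dim_ty A \<Longrightarrow> truncate \<epsilon> n \<Gamma>' = truncate \<epsilon> n \<Gamma>"
    unfolding truncate_def cut by (auto simp: \<Gamma>'_def intro!: filter_cong)
qed

text \<open>
  Cutting off a variable of dimension \<open>n\<close> never removes the last one: the other end of the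
  responsible \<open>(n + 1)\<close>-cell, or of one composable with it, stays.
\<close>

lemma truncate_has_dim:
  assumes "pd \<Gamma> x A" "(z, C) \<in> set \<Gamma>" "n \<le> dim_ty C"
  shows "\<exists>(w, B) \<in> set (truncate \<epsilon> n \<Gamma>). dim_ty B = n"
  using assms
proof (induction arbitrary: z C rule: pd.induct)
  case (pd_point x)
  then show ?case
    by (auto simp: truncate_def is_cut_def)
next
  case (pd_extend \<Gamma> x A y f)
  note ext = truncate_extend[OF pd_extend(1,2,3,4)]
  have xA: "(x, A) \<in> set \<Gamma>"
    using pd_scoped[OF pd_extend(1)] by blast
  consider "Suc (dim_ty A) < n" | "Suc (dim_ty A) = n" | "dim_ty A = n" | "n < dim_ty A"
    by linarith
  then show ?case
  proof cases
    case 1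
    then have "(z, C) \<in> set \<Gamma>"
      using pd_extend.prems by auto
    then show ?thesis
      using pd_extend.IH[of z C] pd_extend.prems ext(1)[of n] 1 by auto
  next
    case 2
    then show ?thesis
      using ext(1)[of n] by auto
  next
    case 3
    then show ?thesis
      using pd_extend.IH[OF xA] ext(2,3)[of n] by (cases \<epsilon>) auto
  next
    case 4
    then show ?thesis
      using pd_extend.IH[OF xA] ext(4)[of n] by auto
  qed
qed

text \<open>
  The part of dimension at most \<open>n\<close> of a type: the type of its boundary in dimension
  \<open>n\<close>.
\<close>

primrec base_ty :: "nat \<Rightarrow> 'v ty \<Rightarrow> 'v ty" where
  "base_ty n Star = Star"
| "base_ty n (Arr s A t) = (if dim_ty A < n then Arr s A t else base_ty n A)"

lemma base_ty_self [simp]: "dim_ty A \<le> n \<Longrightarrow> base_ty n A = A"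
  by (cases A) auto

text \<open>
  While cells of dimension above \<open>n\<close> are glued on, the source truncation does not move, and
  it is ready for extension at the variable \<open>x'\<close> where the first of those cells started.
\<close>

lemma pd_truncate_Neg:
  "pd \<Gamma> x A \<Longrightarrow> \<exists>x'. pd (truncate Neg n \<Gamma>) x' (base_ty n A) \<and> (dim_ty A < n \<longrightarrow> x' = x)"
proof (induction rule: pd.induct)
  case (pd_point x)
  show ?case
    by (intro exI[of _ x]) (auto simp: truncate_def is_cut_def intro: pd.pd_point)
next
  case (pd_extend \<Gamma> x A y f)
  note ext = truncate_extend[OF pd_extend(1,2,3,4)]
  have fresh: "y \<notin> ctx_vars (truncate Neg n \<Gamma>)" "f \<notin> ctx_vars (truncate Neg n \<Gamma>)"
    using pd_extend set_truncate[of Neg n \<Gamma>] by (auto simp: ctx_vars_def)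
  show ?case
  proof (cases "dim_ty A < n")
    case True
    then show ?thesis
      using pd_extend.IH ext(1)[of n] pd.pd_extend[OF _ fresh \<open>y \<noteq> f\<close>, of x A] by auto
  next
    case False
    then have "truncate Neg n (\<Gamma> @ [(y, A), (f, Arr (Var x) A (Var y))]) = truncate Neg n \<Gamma>"
      using ext(2)[of n] ext(4)[of n] by (cases "dim_ty A = n") auto
    then show ?thesis
      using pd_extend.IH False by auto
  qed
next
  case (pd_down \<Gamma> f x A y)
  then show ?case
    by (cases "dim_ty A < n") (auto intro: pd.pd_down)
qed

text \<open>
  In the target truncation the final variable is exchanged each time a cell of dimension
  \<open>n + 1\<close> is glued on. A context with an open end can be extended at its final variable,
  whatever name that variable is given.
\<close>

definition open_end :: "'v ctx \<Rightarrow> 'v \<Rightarrow> 'v ty \<Rightarrow> bool" where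
  "open_end \<Gamma> z B \<longleftrightarrow>
     (\<exists>\<Gamma>\<^sub>0. \<Gamma> = \<Gamma>\<^sub>0 @ [(z, B)] \<and> (\<forall>w. w \<notin> ctx_vars \<Gamma>\<^sub>0 \<longrightarrow> pd (\<Gamma>\<^sub>0 @ [(w, B)]) w B))"

lemma open_end_pd: "open_end \<Gamma> z B \<Longrightarrow> distinct (map fst \<Gamma>) \<Longrightarrow> pd \<Gamma> z B"
  by (auto simp: open_end_def ctx_vars_def)

lemma open_end_extend:
  assumes "pd \<Gamma> x A" "y \<notin> ctx_vars \<Gamma>"
  shows "open_end (\<Gamma> @ [(y, A), (f, Arr (Var x) A (Var y))]) f (Arr (Var x) A (Var y))"
  unfolding open_end_def
  using pd.pd_extend[OF assms] by (intro exI[of _ "\<Gamma> @ [(y, A)]"]) (auto simp: ctx_vars_def)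

lemma open_end_replace:
  assumes "open_end \<Gamma> x A" "distinct (map fst \<Gamma>)"
  shows "open_end (filter (\<lambda>(z, B). z \<noteq> x) \<Gamma> @ [(y, A)]) y A"
proof -
  obtain \<Gamma>\<^sub>0 where \<Gamma>\<^sub>0: "\<Gamma> = \<Gamma>\<^sub>0 @ [(x, A)]" "\<forall>w. w \<notin> ctx_vars \<Gamma>\<^sub>0 \<longrightarrow> pd (\<Gamma>\<^sub>0 @ [(w, A)]) w A"
    using assms(1) by (auto simp: open_end_def)
  have "filter (\<lambda>(z, B). z \<noteq> x) \<Gamma>\<^sub>0 = \<Gamma>\<^sub>0"
    using assms(2) by (force simp: \<Gamma>\<^sub>0(1) filter_id_conv)
  then show ?thesis
    using \<Gamma>\<^sub>0 by (auto simp: open_end_def)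
qed

text \<open>
  Below the critical dimension the truncation is extended like the context itself. In the critical
  dimension the open end is the current variable, and above it the \<open>n\<close>-dimensional target of
  that variable, to which the judgement will return when it descends.
\<close>

lemma pd_truncate_Pos:
  "pd \<Gamma> x A \<Longrightarrow> (dim_ty A < n \<longrightarrow> pd (truncate Pos n \<Gamma>) x A) \<and>
     (dim_ty A = n \<longrightarrow> open_end (truncate Pos n \<Gamma>) x A) \<and>
     (n < dim_ty A \<longrightarrow> (\<exists>z. ty_bd Pos n A = Some (Var z) \<and> open_end (truncate Pos n \<Gamma>) z (base_ty n A)))"
proof (induction rule: pd.induct)
  case (pd_point x)
  have "truncate Pos n [(x, Star)] = [(x, Star)]"
    by (auto simp: truncate_def is_cut_def)
  then show ?case
    by (auto simp: open_end_def intro: pd.pd_point exI[of _ "[]"])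
next
  case (pd_extend \<Gamma> x A y f)
  note ext = truncate_extend[OF pd_extend(1,2,3,4)]
  have fresh: "y \<notin> ctx_vars (truncate Pos n \<Gamma>)" "f \<notin> ctx_vars (truncate Pos n \<Gamma>)"
    using pd_extend set_truncate[of Pos n \<Gamma>] by (auto simp: ctx_vars_def)
  have dist: "distinct (map fst (truncate Pos n \<Gamma>))"
    using pd_distinct[OF pd_extend(1)] by (simp add: truncate_def distinct_map_filter)
  consider "dim_ty A < n" | "dim_ty A = n" | "n < dim_ty A"
    by linarith
  then show ?case
  proof cases
    case 1
    then have "pd (truncate Pos n \<Gamma>) x A"
      using pd_extend.IH by auto
    then show ?thesis
      using 1 ext(1)[of n] pd.pd_extend[OF _ fresh \<open>y \<noteq> f\<close>, of x A] open_end_extend[OF _ fresh(1), of x A f]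
      by auto
  next
    case 2
    then show ?thesis
      using pd_extend.IH ext(3)[of n] open_end_replace[OF _ dist, of x A y] by auto
  next
    case 3
    then show ?thesis
      using pd_extend.IH ext(4)[of n] by auto
  qed
next
  case (pd_down \<Gamma> f x A y)
  have dist: "distinct (map fst (truncate Pos n \<Gamma>))"
    using pd_distinct[OF pd_down(1)] by (simp add: truncate_def distinct_map_filter)
  consider "Suc (dim_ty A) < n" | "Suc (dim_ty A) = n" | "dim_ty A = n" | "n < dim_ty A"
    by linarith
  then show ?case
    using pd_down.IH open_end_pd[OF _ dist] by cases (auto intro: pd.pd_down)
qed

lemma dim_ctx_eq_iff:
  "dim_ctx \<Gamma> = int n \<longleftrightarrow> (\<exists>(x, A) \<in> set \<Gamma>. dim_ty A = n) \<and> (\<forall>(x, A) \<in> set \<Gamma>. dim_ty A \<le> n)"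
  using dim_ctx_less_iff[of \<Gamma> "int n"] dim_ctx_less_iff[of \<Gamma> "int n + 1"]
  by (force simp: not_less)

text \<open>
  The dimension of the boundary must be exact. The unbiased type is defined through its two
  boundaries, and its own iterated boundaries are read off from the negative one only; so both
  boundaries need unbiased types of the same dimension.
\<close>

lemma pasting_ctx_bd:
  assumes "pasting \<Gamma>" "dim_ctx \<Gamma> = int (Suc n)"
  shows "pasting (ctx_bd \<epsilon> \<Gamma>)" "dim_ctx (ctx_bd \<epsilon> \<Gamma>) = int n"
proof -
  obtain x where pd: "pd \<Gamma> x Star"
    using assms(1) unfolding pasting_def by blast
  have bd: "ctx_bd \<epsilon> \<Gamma> = truncate \<epsilon> n \<Gamma>"
    by (rule ctx_bd_eq_truncate[OF assms(2)])
  have dist: "distinct (map fst (truncate \<epsilon> n \<Gamma>))"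
    using pd_distinct[OF pd] by (simp add: truncate_def distinct_map_filter)
  have "\<exists>x'. pd (truncate \<epsilon> n \<Gamma>) x' Star"
  proof (cases \<epsilon>)
    case Neg
    then show ?thesis
      using pd_truncate_Neg[OF pd, of n] by auto
  next
    case Pos
    then show ?thesis
      using pd_truncate_Pos[OF pd, of n] open_end_pd[OF _ dist, of x Star] by auto
  qed
  then show "pasting (ctx_bd \<epsilon> \<Gamma>)"
    unfolding bd pasting_def .
  obtain z C where "(z, C) \<in> set \<Gamma>" "n \<le> dim_ty C"
    using assms(2) unfolding dim_ctx_eq_iff by force
  then show "dim_ctx (ctx_bd \<epsilon> \<Gamma>) = int n"
    using truncate_has_dim[OF pd] unfolding bd dim_ctx_eq_iff by (auto simp: truncate_def)
qed

section \<open>Rank of unbiased types and terms\<close>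

lemma tree_ctx_nonempty: "tree_shape T \<Longrightarrow> tree_ctx T \<noteq> []"
  by (cases T rule: tree_shape.cases) (auto simp: length_Suc_conv)

text \<open>
  The context of a linear tree lists, level by level, a pair of parallel variables, and ends with the
  single label of its leaf.
\<close>

lemma linear_tree_last_top_dim:
  "linear T \<Longrightarrow> tree_shape T \<Longrightarrow> (z, C) \<in> set (tree_ctx T) \<Longrightarrow> dim_ty C \<le> dim_ty (snd (last (tree_ctx T)))"
proof (induction T arbitrary: z C rule: linear.induct)
  case (1 ls)
  then show ?case by (auto simp: length_Suc_conv)
next
  case (2 ls t)
  then obtain a b where ls: "ls = [a, b]"
    by (auto simp: length_Suc_conv)
  have "tree_ctx t \<noteq> []"
    using 2 tree_ctx_nonempty by auto
  then have "dim_ty (snd (last (tree_ctx (Node ls [t])))) = Suc (dim_ty (snd (last (tree_ctx t))))"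
    by (simp add: ls suspend_ctx_def last_map)
  then show ?case
    using 2 by (auto simp: ls suspend_ctx_def)
qed auto

lemma disc_last_top_dim:
  assumes "disc \<Gamma>"
  shows "last \<Gamma> \<in> set \<Gamma>" "dim_ctx \<Gamma> = int (dim_ty (snd (last \<Gamma>)))"
proof -
  have T: "tree_shape (ctx_tree \<Gamma>)" "tree_ctx (ctx_tree \<Gamma>) = \<Gamma>" "linear (ctx_tree \<Gamma>)"
    using assms pasting_tree[of \<Gamma>] by (auto simp: disc_def wf_tree_def)
  show last: "last \<Gamma> \<in> set \<Gamma>"
    using tree_ctx_nonempty[OF T(1)] T(2) by simp
  show "dim_ctx \<Gamma> = int (dim_ty (snd (last \<Gamma>)))"
    unfolding dim_ctx_eq_iff using linear_tree_last_top_dim[OF T(3,1)] last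
    by (auto simp: T(2) intro!: bexI[of _ "last \<Gamma>"])
qed

text \<open>
  This excludes dimension \<open>0\<close> in the recursive clause of \<open>UTy\<close>, so that the
  boundaries there have a smaller natural number as dimension.
\<close>

lemma point_disc:
  assumes "pasting \<Gamma>" "dim_ctx \<Gamma> = 0"
  shows "disc \<Gamma>"
proof -
  obtain ls ts where T: "ctx_tree \<Gamma> = Node ls ts"
    by (cases "ctx_tree \<Gamma>")
  have shape: "tree_shape (Node ls ts)" "tree_ctx (Node ls ts) = \<Gamma>"
    using pasting_tree[OF assms(1)] by (auto simp: T wf_tree_def)
  have dims: "\<forall>(x, A) \<in> set \<Gamma>. dim_ty A = 0"
    using assms(2) dim_ctx_eq_iff[of \<Gamma> 0] by auto
  have "ts = []"
  proof (rule ccontr)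
    assume "ts \<noteq> []"
    then obtain t ts' a b ls' where *: "ts = t # ts'" "ls = a # b # ls'"
      using shape(1) by (cases ts) (auto simp: length_Suc_conv)
    then have "tree_ctx t \<noteq> []"
      using shape(1) tree_ctx_nonempty by auto
    then obtain z C where "(z, C) \<in> set (tree_ctx t)"
      by (metis list.set_intros(1) neq_Nil_conv prod.exhaust)
    then have "(z, suspend_ty a b C) \<in> set \<Gamma>"
      unfolding shape(2)[symmetric] * by (force simp: suspend_ctx_def)
    then show False
      using dims by fastforce
  qed
  then show ?thesis
    using assms(1) by (simp add: disc_def T)
qed

lemma ty_bd_less: "ty_bd \<epsilon> m A = Some t \<Longrightarrow> m < dim_ty A"
proof (induction A rule: ty.induct[where ?P2.0 = "\<lambda>_. True"])
  case (Arr s A u)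
  then show ?case by (cases "m = dim_ty A") auto
qed auto

text \<open>
  A type is made of its boundary terms in dimensions \<open>0, \<dots>, dim A - 1\<close>.
\<close>

lemma rank_ty_le_dim:
  "(\<And>\<epsilon> m t. ty_bd \<epsilon> m A = Some t \<Longrightarrow> rank_tm t e \<le> Suc m) \<Longrightarrow> rank_ty A e \<le> dim_ty A"
proof (induction A rule: ty.induct[where ?P2.0 = "\<lambda>_. True"])
  case (Arr s A t)
  have "rank_ty A e \<le> dim_ty A"
  proof (rule Arr.IH(1))
    fix \<epsilon> m u assume "ty_bd \<epsilon> m A = Some u"
    then show "rank_tm u e \<le> Suc m"
      using Arr.prems[of \<epsilon> m u] ty_bd_less by force
  qed
  then show ?case
    using Arr.prems[of Neg "dim_ty A" s] Arr.prems[of Pos "dim_ty A" t] by simp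
qed auto

text \<open>
  Ranks of unbiased terms are estimated under all assignments of this kind. The quantification
  is what lets an estimate over \<open>\<partial>\<Gamma>\<close> be reused over \<open>\<Gamma>\<close>, or
  over an insertion into which \<open>\<Gamma>\<close> is embedded.
\<close>

definition dim_bounded :: "'v ctx \<Rightarrow> ('v \<Rightarrow> nat) \<Rightarrow> bool" where
  "dim_bounded \<Gamma> e \<longleftrightarrow> (\<forall>(z, C) \<in> set \<Gamma>. e z \<le> Suc (dim_ty C))"

lemma dim_env_eq: "distinct (map fst \<Gamma>) \<Longrightarrow> (z, C) \<in> set \<Gamma> \<Longrightarrow> dim_env \<Gamma> z = Suc (dim_ty C)"
  by (simp add: dim_env_def)

lemma dim_bounded_dim_env: "pasting \<Gamma> \<Longrightarrow> dim_bounded \<Gamma> (dim_env \<Gamma>)"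
  unfolding pasting_def dim_bounded_def by (auto simp: dim_env_eq pd_distinct)

text \<open>
  An unbiased composite of dimension \<open>n\<close> has rank at most \<open>n + 1\<close>, like a
  variable of that dimension. Indeed its type consists of unbiased terms of dimensions less than
  \<open>n\<close>, hence has rank at most \<open>n\<close>, and the coherence adds one. The boundaries of
  the unbiased type obey the same bound in each dimension because they are themselves unbiased terms,
  over iterated boundaries of the context.
\<close>

lemma rank_unbiased_le:
  fixes \<Gamma> :: "'v ctx"
  shows "pasting \<Gamma> \<Longrightarrow> dim_bounded \<Gamma> e \<Longrightarrow> rank_tm (UTm \<Gamma>) e \<le> Suc (nat (dim_ctx \<Gamma>))"
    and "pasting \<Gamma> \<Longrightarrow> dim_ctx \<Gamma> = int (dim_ty (UTy \<Gamma>)) \<and>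
      (\<forall>e \<epsilon> m t. dim_bounded \<Gamma> e \<longrightarrow> ty_bd \<epsilon> m (UTy \<Gamma>) = Some t \<longrightarrow> rank_tm t e \<le> Suc m)"
proof (induction \<Gamma> and \<Gamma> arbitrary: e and rule: UTm_UTy.induct)
  case (1 \<Gamma>)
  show ?case
  proof (cases "disc \<Gamma>")
    case True
    have "e (fst (last \<Gamma>)) \<le> Suc (dim_ty (snd (last \<Gamma>)))"
      using disc_last_top_dim(1)[OF True] 1(3) by (force simp: dim_bounded_def)
    then show ?thesis
      using True disc_last_top_dim(2)[OF True] by (simp add: UTm.simps)
  next
    case False
    note IH = 1(1)[OF False 1(2)]
    have "rank_ty (UTy \<Gamma>) (dim_env \<Gamma>) \<le> dim_ty (UTy \<Gamma>)"
      using IH dim_bounded_dim_env[OF 1(2)] by (intro rank_ty_le_dim) blast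
    moreover have "e z \<le> Suc (dim_ty (UTy \<Gamma>))" if "(z, C) \<in> set \<Gamma>" for z C
      using that 1(3) IH dim_ctx_eq_iff[of \<Gamma> "dim_ty (UTy \<Gamma>)"] by (fastforce simp: dim_bounded_def)
    ultimately show ?thesis
      using False IH by (auto simp: UTm.simps rank_Coh_le_iff id_sub_def)
  qed
next
  case (2 \<Gamma>)
  show ?case
  proof (cases "disc \<Gamma>")
    case True
    then obtain x where pd: "pd \<Gamma> x Star"
      using 2 unfolding pasting_def by blast
    have "rank_tm t e \<le> Suc m" if "dim_bounded \<Gamma> e" "ty_bd \<epsilon> m (snd (last \<Gamma>)) = Some t" for e \<epsilon> m t
      using that pd_scopedD[OF pd, of "fst (last \<Gamma>)" "snd (last \<Gamma>)"] disc_last_top_dim(1)[OF True]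
      by (fastforce simp: dim_bounded_def)
    then show ?thesis
      using True disc_last_top_dim(2)[OF True] by (simp add: UTy.simps)
  next
    case False
    then have "dim_ctx \<Gamma> \<noteq> 0"
      using point_disc[OF \<open>pasting \<Gamma>\<close>] by blast
    moreover have "0 \<le> dim_ctx \<Gamma>"
      using 2 dim_ctx_nonneg pd_nonempty unfolding pasting_def by metis
    ultimately obtain n where n: "dim_ctx \<Gamma> = int (Suc n)"
      by (metis not0_implies_Suc of_nat_0 zero_le_imp_eq_int)
    note bd = pasting_ctx_bd[OF \<open>pasting \<Gamma>\<close> n]
    have UTy: "UTy \<Gamma> = Arr (UTm (ctx_bd Neg \<Gamma>)) (UTy (ctx_bd Neg \<Gamma>)) (UTm (ctx_bd Pos \<Gamma>))"
      using False 2 by (subst UTy.simps) simp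
    have dim: "dim_ty (UTy (ctx_bd Neg \<Gamma>)) = n"
      using 2 False bd by force
    have bounded: "dim_bounded (ctx_bd \<epsilon> \<Gamma>) e" if "dim_bounded \<Gamma> e" for \<epsilon> e
      using that by (auto simp: dim_bounded_def ctx_bd_def)
    have "rank_tm t e \<le> Suc m" if e: "dim_bounded \<Gamma> e" and t: "ty_bd \<epsilon> m (UTy \<Gamma>) = Some t" for e \<epsilon> m t
    proof (cases "m = n")
      case True
      then have "t = UTm (ctx_bd \<epsilon> \<Gamma>)"
        using t by (cases \<epsilon>) (auto simp: UTy dim)
      then show ?thesis
        using 2 False bd[of \<epsilon>] bounded[OF e, of \<epsilon>] True by (cases \<epsilon>) auto
    next
      case False
      then have "ty_bd \<epsilon> m (UTy (ctx_bd Neg \<Gamma>)) = Some t"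
        using t by (auto simp: UTy dim)
      then show ?thesis
        using 2 \<open>\<not> disc \<Gamma>\<close> bd[of Neg] bounded[OF e] by blast
    qed
    then show ?thesis
      using n by (auto simp: UTy dim)
  qed
qed

section \<open>Effect of an insertion on counts and rank\<close>

text \<open>
  The multiset inclusion \<open>insert_ctx_levels\<close>, read for variables: as \<open>\<Delta>\<close>
  and \<open>\<Theta>\<close> are disjoint, the right-hand side has no repetition, and the one occurrence
  of \<open>x\<close> is already used up.
\<close>

lemma insert_ctx_vars:
  assumes "pasting \<Delta>" "pasting \<Theta>" "x \<in> ctx_vars \<Delta>" "branching_path (ctx_tree \<Delta>) x p"
    "length p - 1 \<le> linear_height (ctx_tree \<Theta>)" "ctx_vars \<Delta> \<inter> ctx_vars \<Theta> = {}"
  shows "distinct (map fst (insert_ctx \<Delta> p \<Theta>))" "x \<notin> ctx_vars (insert_ctx \<Delta> p \<Theta>)"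
    "z \<in> ctx_vars \<Delta> \<Longrightarrow> dim_env (insert_ctx \<Delta> p \<Theta>) z \<le> dim_env \<Delta> z"
    "z \<in> ctx_vars \<Theta> \<Longrightarrow> dim_env (insert_ctx \<Delta> p \<Theta>) z \<le> dim_env \<Theta> z"
proof -
  obtain k where k: "add_mset (x, k) (ctx_levels 0 (insert_ctx \<Delta> p \<Theta>)) \<subseteq># ctx_levels 0 \<Delta> + ctx_levels 0 \<Theta>"
    using insert_ctx_levels[OF assms(1-5)] by auto
  have dist: "distinct (map fst \<Delta>)" "distinct (map fst \<Theta>)"
    using assms(1,2) pd_distinct unfolding pasting_def by auto
  have dist_append: "distinct (map fst \<Delta> @ map fst \<Theta>)"
    using dist assms(6) by (auto simp: ctx_vars_def)
  have sub: "mset (x # map fst (insert_ctx \<Delta> p \<Theta>)) \<subseteq># mset (map fst \<Delta> @ map fst \<Theta>)"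
    using image_mset_subseteq_mono[OF k, of fst] by (simp add: fst_ctx_levels)
  obtain R where "mset (map fst \<Delta> @ map fst \<Theta>) = mset (x # map fst (insert_ctx \<Delta> p \<Theta>)) + R"
    using sub unfolding mset_subset_eq_exists_conv by blast
  moreover obtain zs where "mset zs = R"
    using ex_mset by blast
  ultimately have "mset (map fst \<Delta> @ map fst \<Theta>) = mset ((x # map fst (insert_ctx \<Delta> p \<Theta>)) @ zs)"
    by simp
  then have "distinct ((x # map fst (insert_ctx \<Delta> p \<Theta>)) @ zs)"
    using dist_append mset_eq_imp_distinct_iff by blast
  then have "distinct (x # map fst (insert_ctx \<Delta> p \<Theta>))"
    by simp
  then show dist': "distinct (map fst (insert_ctx \<Delta> p \<Theta>))" "x \<notin> ctx_vars (insert_ctx \<Delta> p \<Theta>)"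
    by (auto simp: ctx_vars_def)
  \<comment> \<open>A variable of the insertion keeps the dimension that it has in \<open>\<Delta>\<close> or \<open>\<Theta>\<close>.\<close>
  have entry: "(z, dim_ty C) \<in># ctx_levels 0 \<Delta> + ctx_levels 0 \<Theta>" if "(z, C) \<in> set (insert_ctx \<Delta> p \<Theta>)" for z C
  proof -
    have "(z, dim_ty C) \<in># ctx_levels 0 (insert_ctx \<Delta> p \<Theta>)"
      using that by (force simp: ctx_levels_def)
    then show ?thesis
      using mset_subset_eqD[OF k] by auto
  qed
  have level_imp: "dim_env \<Gamma> z = Suc d" "z \<in> ctx_vars \<Gamma>"
    if "(z, d) \<in># ctx_levels 0 \<Gamma>" "distinct (map fst \<Gamma>)" for z d and \<Gamma> :: "'a ctx"
    using that by (force simp: ctx_levels_def dim_env_def ctx_vars_def)+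
  have env: "dim_env (insert_ctx \<Delta> p \<Theta>) z = Suc (dim_ty C)" "(z, C) \<in> set (insert_ctx \<Delta> p \<Theta>)"
    if "map_of (insert_ctx \<Delta> p \<Theta>) z = Some C" for C
    using that by (auto simp: dim_env_def dest: map_of_SomeD)
  show "dim_env (insert_ctx \<Delta> p \<Theta>) z \<le> dim_env \<Delta> z" if "z \<in> ctx_vars \<Delta>"
  proof (cases "map_of (insert_ctx \<Delta> p \<Theta>) z")
    case (Some C)
    then show ?thesis
      using env[OF Some] entry[of z C] level_imp(1)[of z "dim_ty C" \<Delta>] level_imp(2)[of z "dim_ty C" \<Theta>]
        dist that assms(6) by auto
  qed (simp add: dim_env_def)
  show "dim_env (insert_ctx \<Delta> p \<Theta>) z \<le> dim_env \<Theta> z" if "z \<in> ctx_vars \<Theta>"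
  proof (cases "map_of (insert_ctx \<Delta> p \<Theta>) z")
    case (Some C)
    then show ?thesis
      using env[OF Some] entry[of z C] level_imp(1)[of z "dim_ty C" \<Theta>] level_imp(2)[of z "dim_ty C" \<Delta>]
        dist that assms(6) by auto
  qed (simp add: dim_env_def)
qed

text \<open>
  The external substitution replaces a variable \<open>y\<close> of dimension \<open>m\<close> either by
  itself or by the \<open>m\<close>-dimensional boundary of an unbiased coherence, which
  \<open>rank_unbiased_le\<close> shows to have the rank \<open>m + 1\<close> of \<open>y\<close> at most.
  That the boundary is taken in the dimension of \<open>y\<close> is essential: the dimension of
  \<open>\<Theta>\<close> itself is not related to that of \<open>x\<close> for ill-typed terms.
\<close>

lemma rank_external_sub:
  assumes "pasting \<Delta>" "pasting \<Theta>" "x \<in> ctx_vars \<Delta>" "branching_path (ctx_tree \<Delta>) x p"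
    "length p - 1 \<le> linear_height (ctx_tree \<Theta>)" "ctx_vars \<Delta> \<inter> ctx_vars \<Theta> = {}"
    "external_sub \<Delta> x p \<Theta> (UTy \<Theta>) \<kappa>" "map_of \<kappa> y = Some t"
  shows "rank_tm t (dim_env (insert_ctx \<Delta> p \<Theta>)) \<le> dim_env \<Delta> y"
proof -
  let ?\<Gamma> = "insert_ctx \<Delta> p \<Theta>"
  note ins = insert_ctx_vars[OF assms(1-6)]
  have yt: "(y, t) \<in> set \<kappa>"
    using assms(8) by (rule map_of_SomeD)
  have "y \<in> fst ` set \<kappa>"
    using yt by force
  then have y: "y \<in> ctx_vars \<Delta>"
    using assms(7) unfolding external_sub_def ctx_vars_def by (metis list.set_map)
  show ?thesis
  proof (cases "y \<in> ctx_vars ?\<Gamma>")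
    case True
    then have "t = Var y"
      using assms(7) yt unfolding external_sub_def by auto
    then show ?thesis
      using ins(3)[OF y] by simp
  next
    case False
    then obtain \<epsilon> m where y_bd: "tm_bd \<Delta> \<epsilon> m (Var x) = Some (Var y)"
      and t_bd: "tm_bd ?\<Gamma> \<epsilon> m (Coh \<Theta> (UTy \<Theta>) (id_sub \<Theta>)) = Some t"
      using assms(7) yt unfolding external_sub_def by (auto split: if_splits)
    obtain w where pd: "pd \<Delta> w Star"
      using assms(1) unfolding pasting_def by auto
    obtain C where C: "map_of \<Delta> x = Some C"
      using y_bd by (auto simp: tm_bd_def bind_eq_Some_conv split: if_splits)
    \<comment> \<open>A boundary of \<open>x\<close> in dimension \<open>m\<close> is a variable of dimension \<open>m\<close>.\<close>
    have m: "dim_env \<Delta> y = Suc m"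
    proof (cases "dim_ty C = m")
      case True
      then show ?thesis
        using y_bd C by (simp add: tm_bd_def dim_env_def)
    next
      case False
      then have "ty_bd \<epsilon> m C = Some (Var y)"
        using y_bd C by (simp add: tm_bd_def)
      then obtain B where "(y, B) \<in> set \<Delta>" "dim_ty B = m"
        using pd_scopedD[OF pd map_of_SomeD[OF C]] by blast
      then show ?thesis
        using dim_env_eq[OF pd_distinct[OF pd]] by blast
    qed
    have \<Theta>: "dim_bounded \<Theta> (dim_env ?\<Gamma>)"
      unfolding dim_bounded_def
    proof clarify
      fix z C assume z: "(z, C) \<in> set \<Theta>"
      then have "z \<in> ctx_vars \<Theta>"
        by (force simp: ctx_vars_def)
      then have "dim_env ?\<Gamma> z \<le> dim_env \<Theta> z"
        by (rule ins(4))
      also have "\<dots> \<le> Suc (dim_ty C)"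
        using dim_bounded_dim_env[OF assms(2)] z by (auto simp: dim_bounded_def)
      finally show "dim_env ?\<Gamma> z \<le> Suc (dim_ty C)" .
    qed
    note unb = rank_unbiased_le(2)[OF assms(2)]
    have "rank_tm t (dim_env ?\<Gamma>) \<le> Suc m"
    proof (cases "dim_ty (UTy \<Theta>) = m")
      case True
      then have t: "t = Coh \<Theta> (UTy \<Theta>) (id_sub \<Theta>)"
        using t_bd by (simp add: tm_bd_def)
      have "rank_ty (UTy \<Theta>) (dim_env \<Theta>) \<le> m"
        using unb dim_bounded_dim_env[OF assms(2)] unfolding True[symmetric]
        by (intro rank_ty_le_dim) blast
      moreover have "dim_env ?\<Gamma> z \<le> Suc m" if "(z, C) \<in> set \<Theta>" for z C
        using that \<Theta> unb dim_ctx_eq_iff[of \<Theta> m] True by (fastforce simp: dim_bounded_def)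
      ultimately show ?thesis
        unfolding t rank_Coh_le_iff by (auto simp: id_sub_def)
    next
      case False
      then obtain u where u: "ty_bd \<epsilon> m (UTy \<Theta>) = Some u" "subst_tm (id_sub \<Theta>) u = Some t"
        using t_bd by (auto simp: tm_bd_def bind_eq_Some_conv)
      have "rank_tm s (dim_env ?\<Gamma>) \<le> dim_env \<Theta> z" if "map_of (id_sub \<Theta>) z = Some s" for z s
        using map_of_SomeD[OF that] ins(4)[of z] by (force simp: id_sub_def ctx_vars_def)
      then have "rank_tm t (dim_env ?\<Gamma>) \<le> rank_tm u (dim_env \<Theta>)"
        using rank_subst_le(2) u(2) by metis
      also have "\<dots> \<le> Suc m"
        using unb u(1) dim_bounded_dim_env[OF assms(2)] by blast
      finally show ?thesis .
    qed
    then show ?thesis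
      using m by simp
  qed
qed

lemma insert_sub_entries:
  assumes "insert_sub \<Delta> p \<Theta> \<sigma> \<tau> = Some \<sigma>'"
  shows "map fst \<sigma>' = map fst (insert_ctx \<Delta> p \<Theta>)"
    and "(z, t) \<in> set \<sigma>' \<Longrightarrow> (if z \<in> ctx_vars \<Theta> then map_of \<tau> z else map_of \<sigma> z) = Some t"
proof -
  have eq: "map (\<lambda>(z, A). (z, if z \<in> ctx_vars \<Theta> then map_of \<tau> z else map_of \<sigma> z)) (insert_ctx \<Delta> p \<Theta>)
      = map (map_prod id Some) \<sigma>'"
    using collect_sub_SomeD[OF assms[unfolded insert_sub_def]] .
  show "map fst \<sigma>' = map fst (insert_ctx \<Delta> p \<Theta>)"
    using arg_cong[OF eq, of "map fst"] by (simp add: o_def case_prod_unfold)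
  assume "(z, t) \<in> set \<sigma>'"
  then have "(z, Some t) \<in> set (map (map_prod id Some) \<sigma>')"
    by force
  then show "(if z \<in> ctx_vars \<Theta> then map_of \<tau> z else map_of \<sigma> z) = Some t"
    unfolding eq[symmetric] by auto
qed

text \<open>
  The keys of \<open>\<sigma>\<close> may repeat; further entries only increase the right-hand side.
\<close>

lemma sum_entries_le:
  fixes g :: "'a \<Rightarrow> nat"
  assumes "finite K" "\<And>z. z \<in> K \<Longrightarrow> map_of \<sigma> z = Some (f z)"
  shows "(\<Sum>z\<in>K. g (f z)) \<le> (\<Sum>t\<leftarrow>map snd \<sigma>. g t)"
  using assms
proof (induction \<sigma> arbitrary: K)
  case (Cons p \<sigma>)
  obtain y u where p: "p = (y, u)"
    by (cases p)
  have "(\<Sum>z\<in>K - {y}. g (f z)) \<le> (\<Sum>t\<leftarrow>map snd \<sigma>. g t)"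
  proof (rule Cons.IH)
    show "map_of \<sigma> z = Some (f z)" if "z \<in> K - {y}" for z
      using Cons.prems(2)[of z] that by (simp add: p)
  qed (use Cons.prems in simp)
  moreover have "(\<Sum>z\<in>K. g (f z)) \<le> g u + (\<Sum>z\<in>K - {y}. g (f z))"
  proof (cases "y \<in> K")
    case True
    then have "f y = u"
      using Cons.prems(2)[of y] by (simp add: p)
    then show ?thesis
      using True Cons.prems(1) by (simp add: sum.remove)
  qed simp
  ultimately show ?case
    by (simp add: p)
qed auto

text \<open>
  Each entry of the inserted substitution uses a different entry of \<open>\<sigma>\<close> or of
  \<open>\<tau>\<close>, and none of them uses the entry \<open>u\<close> of \<open>x\<close>. For
  \<open>u = coh(\<Theta> : B)[\<tau>]\<close> the count of \<open>\<tau>\<close> is part of that of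
  \<open>u\<close>, which leaves a surplus of one coherence at depth \<open>0\<close>.
\<close>

lemma cohs_insert_sub:
  assumes "insert_sub \<Delta> p \<Theta> \<sigma> \<tau> = Some \<sigma>'" "map_of \<sigma> x = Some u"
    "distinct (map fst (insert_ctx \<Delta> p \<Theta>))" "x \<notin> ctx_vars (insert_ctx \<Delta> p \<Theta>)" "x \<notin> ctx_vars \<Theta>"
  shows "cohs_sub \<sigma>' j + cohs_tm u j \<le> cohs_sub \<sigma> j + cohs_sub \<tau> j"
proof -
  let ?g = "\<lambda>t. cohs_tm t j"
  let ?K = "set (map fst (insert_ctx \<Delta> p \<Theta>))"
  note entries = insert_sub_entries[OF assms(1)]
  have keys: "map fst \<sigma>' = map fst (insert_ctx \<Delta> p \<Theta>)"
    by (rule entries)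
  have dist: "distinct (map fst \<sigma>')"
    using assms(3) keys by simp
  define f where "f z = the (if z \<in> ctx_vars \<Theta> then map_of \<tau> z else map_of \<sigma> z)" for z
  have f: "f (fst q) = snd q" if "q \<in> set \<sigma>'" for q
    using entries(2)[of "fst q" "snd q"] that by (simp add: f_def)
  have "cohs_sub \<sigma>' j = (\<Sum>q\<leftarrow>\<sigma>'. ?g (f (fst q)))"
    using f by (auto simp: o_def intro!: arg_cong[where f = sum_list])
  also have "\<dots> = (\<Sum>z\<leftarrow>map fst \<sigma>'. ?g (f z))"
    by (simp add: o_def)
  also have "\<dots> = (\<Sum>z\<in>?K. ?g (f z))"
    using assms(3) unfolding keys by (rule sum_list_distinct_conv_sum_set)
  also have "\<dots> = (\<Sum>z\<in>?K \<inter> ctx_vars \<Theta>. ?g (f z)) + (\<Sum>z\<in>?K - ctx_vars \<Theta>. ?g (f z))"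
    by (intro sum.Int_Diff) simp
  finally have split: "cohs_sub \<sigma>' j = \<dots>" .
  have defined: "(if z \<in> ctx_vars \<Theta> then map_of \<tau> z else map_of \<sigma> z) = Some (f z)" if "z \<in> ?K" for z
  proof -
    have "z \<in> set (map fst \<sigma>')"
      using that keys by simp
    then obtain t where "(z, t) \<in> set \<sigma>'"
      by auto
    then show ?thesis
      using entries(2) by (auto simp: f_def)
  qed
  have "(\<Sum>z\<in>?K \<inter> ctx_vars \<Theta>. ?g (f z)) \<le> cohs_sub \<tau> j"
  proof (rule sum_entries_le)
    show "map_of \<tau> z = Some (f z)" if "z \<in> ?K \<inter> ctx_vars \<Theta>" for z
      using defined[of z] that by simp
  qed simp
  moreover have "(\<Sum>z\<in>?K - ctx_vars \<Theta>. ?g (f z)) + ?g u \<le> cohs_sub \<sigma> j"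
  proof -
    \<comment> \<open>Adding the unused key \<open>x\<close> accounts for the entry that the insertion consumes.\<close>
    let ?f = "f(x := u)"
    have x: "x \<notin> ?K"
      using assms(4) by (simp add: ctx_vars_def)
    have "(\<Sum>z\<in>insert x (?K - ctx_vars \<Theta>). ?g (?f z)) \<le> cohs_sub \<sigma> j"
    proof (rule sum_entries_le)
      show "map_of \<sigma> z = Some (?f z)" if "z \<in> insert x (?K - ctx_vars \<Theta>)" for z
        using defined[of z] that assms(2) by (auto simp del: set_map)
    qed simp
    moreover have "(\<Sum>z\<in>?K - ctx_vars \<Theta>. ?g (?f z)) = (\<Sum>z\<in>?K - ctx_vars \<Theta>. ?g (f z))"
      using x by (intro sum.cong) auto
    ultimately show ?thesis
      using x by simp
  qed
  ultimately show ?thesis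
    using split by linarith
qed

section \<open>Strong normalisation\<close>

definition lex_decreases :: "(nat \<Rightarrow> nat) \<Rightarrow> (nat \<Rightarrow> nat) \<Rightarrow> bool" where
  "lex_decreases v w \<longleftrightarrow> (\<exists>j. w j < v j \<and> (\<forall>i<j. w i = v i))"

text \<open>
  An insertion at type depth \<open>j\<close> removes a coherence at depth \<open>j\<close>, changes
  nothing at smaller depths, and may change the counts at greater ones in any way, as
  \<open>A\<close> becomes \<open>A[\<kappa>]\<close> there.
\<close>

lemma step_measures:
  fixes A A' :: "'v ty" and \<sigma> \<sigma>' :: "'v sub" and t t' :: "'v tm"
  shows "step_ty A A' \<Longrightarrow> (\<forall>e. rank_ty A' e \<le> rank_ty A e) \<and>
      lex_decreases (cohs_ty A) (cohs_ty A')"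
    and "step_sub \<sigma> \<sigma>' \<Longrightarrow>
      (\<forall>e k. (\<forall>t \<in> snd ` set \<sigma>. rank_tm t e \<le> k) \<longrightarrow> (\<forall>t \<in> snd ` set \<sigma>'. rank_tm t e \<le> k)) \<and>
      lex_decreases (cohs_sub \<sigma>) (cohs_sub \<sigma>')"
    and "step_tm t t' \<Longrightarrow> (\<forall>e. rank_tm t' e \<le> rank_tm t e) \<and> lex_decreases (cohs_tm t) (cohs_tm t')"
proof (induction rule: step_ty_step_sub_step_tm.inducts)
  case (step_src s s' A t)
  then show ?case
    by (auto simp: lex_decreases_def max.coboundedI1)
next
  case (step_base A A' s t)
  then show ?case
    by (auto simp: lex_decreases_def intro: max.coboundedI1 max.coboundedI2)
next
  case (step_tgt t t' s A)
  then show ?case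
    by (auto simp: lex_decreases_def intro: max.coboundedI2)
next
  case (step_entry t t' \<sigma> x \<sigma>')
  then have "rank_tm t' e \<le> k" if "rank_tm t e \<le> k" for e k
    using that le_trans by blast
  moreover have "lex_decreases (cohs_sub (\<sigma> @ (x, t) # \<sigma>')) (cohs_sub (\<sigma> @ (x, t') # \<sigma>'))"
    using step_entry by (simp add: lex_decreases_def)
  ultimately show ?case
    by simp
next
  case (step_coh_ty A A' \<Delta> \<sigma>)
  then have rank: "rank_ty A' (dim_env \<Delta>) \<le> rank_ty A (dim_env \<Delta>)"
    by blast
  have "rank_tm (Coh \<Delta> A' \<sigma>) e \<le> rank_tm (Coh \<Delta> A \<sigma>) e" for e
    using rank rank_Coh_le_iff[of \<Delta> A \<sigma> e "rank_tm (Coh \<Delta> A \<sigma>) e"]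
    unfolding rank_Coh_le_iff[of \<Delta> A'] by auto
  moreover obtain j where "cohs_ty A' j < cohs_ty A j" "\<forall>i<j. cohs_ty A' i = cohs_ty A i"
    using step_coh_ty unfolding lex_decreases_def by blast
  then have "lex_decreases (cohs_tm (Coh \<Delta> A \<sigma>)) (cohs_tm (Coh \<Delta> A' \<sigma>))"
    unfolding lex_decreases_def
    by (intro exI[of _ "Suc j"]) (auto simp: cohs_Coh split: nat.split)
  ultimately show ?case by blast
next
  case (step_coh_sub \<sigma> \<sigma>' \<Delta> A)
  have "rank_tm (Coh \<Delta> A \<sigma>') e \<le> rank_tm (Coh \<Delta> A \<sigma>) e" for e
    using step_coh_sub rank_Coh_le_iff[of \<Delta> A \<sigma> e "rank_tm (Coh \<Delta> A \<sigma>) e"]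
    unfolding rank_Coh_le_iff[of \<Delta> A \<sigma>'] by blast
  moreover have "lex_decreases (cohs_tm (Coh \<Delta> A \<sigma>)) (cohs_tm (Coh \<Delta> A \<sigma>'))"
    using step_coh_sub unfolding lex_decreases_def by (auto simp: cohs_Coh)
  ultimately show ?case by blast
next
  case (step_insertion \<Delta> x \<sigma> \<Theta> B \<tau> p \<kappa> A A' \<sigma>')
  let ?\<Gamma> = "insert_ctx \<Delta> p \<Theta>"
  have x: "x \<in> ctx_vars \<Delta>"
    using step_insertion by (simp add: locally_maximal_def)
  note hyps = \<open>pasting \<Delta>\<close> \<open>pasting \<Theta>\<close> x step_insertion(7,8,6)
  have "rank_tm (Coh ?\<Gamma> A' \<sigma>') e \<le> rank_tm (Coh \<Delta> A \<sigma>) e" for e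
  proof -
    let ?k = "rank_tm (Coh \<Delta> A \<sigma>) e"
    have k: "Suc (rank_ty A (dim_env \<Delta>)) \<le> ?k" "\<And>t. t \<in> snd ` set \<sigma> \<Longrightarrow> rank_tm t e \<le> ?k"
      using rank_Coh_le_iff[of \<Delta> A \<sigma> e ?k] by auto
    have "rank_ty A' (dim_env ?\<Gamma>) \<le> rank_ty A (dim_env \<Delta>)"
      using rank_external_sub[OF hyps] step_insertion(5,9,10) by (intro rank_subst_le(1)) auto
    moreover have "rank_tm (Coh \<Theta> B \<tau>) e \<le> ?k"
      using map_of_SomeD[OF step_insertion(3)] k(2) by force
    then have "rank_tm t e \<le> ?k" if "t \<in> snd ` set \<tau>" for t
      using that rank_Coh_le_iff by blast
    then have "rank_tm t e \<le> ?k" if "(z, t) \<in> set \<sigma>'" for z t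
      using insert_sub_entries(2)[OF step_insertion(11) that] k(2)
      by (force dest: map_of_SomeD split: if_splits)
    ultimately show ?thesis
      unfolding rank_Coh_le_iff using k(1) by auto
  qed
  moreover have "x \<notin> ctx_vars \<Theta>"
    using x step_insertion(6) by blast
  then have "cohs_tm (Coh ?\<Gamma> A' \<sigma>') 0 < cohs_tm (Coh \<Delta> A \<sigma>) 0"
    using cohs_insert_sub[OF step_insertion(11,3) insert_ctx_vars(1,2)[OF hyps], of 0]
    by (simp add: cohs_Coh)
  then have "lex_decreases (cohs_tm (Coh \<Delta> A \<sigma>)) (cohs_tm (Coh ?\<Gamma> A' \<sigma>'))"
    unfolding lex_decreases_def by blast
  ultimately show ?case by blast
qed

text \<open>
  The lexicographic order on infinite sequences of numbers is not well-founded, whence the common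
  bound \<open>N\<close> on the supports: it reduces the claim to lists of length \<open>N\<close>.
\<close>

lemma no_infinite_lex_descent:
  fixes v :: "nat \<Rightarrow> nat \<Rightarrow> nat"
  assumes dec: "\<And>i. lex_decreases (v i) (v (Suc i))" and zero: "\<And>i j. N \<le> j \<Longrightarrow> v i j = 0"
  shows False
proof -
  let ?w = "\<lambda>i. map (v i) [0..<N]"
  have "(?w (Suc i), ?w i) \<in> lexn less_than N" for i
  proof -
    obtain j where j: "v (Suc i) j < v i j" "\<forall>k<j. v (Suc i) k = v i k"
      using dec[of i] unfolding lex_decreases_def by blast
    \<comment> \<open>Where the count decreases it was positive, so the decrease lies within the first \<open>N\<close> entries.\<close>
    then have "j < N"
      using zero[of j i] by (metis less_nat_zero_code not_le_imp_less)
    then have "[0..<N] = [0..<j] @ j # [Suc j..<N]"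
      by (metis le_add_same_cancel1 less_imp_le upt_add_eq_append upt_conv_Cons zero_le le_add_diff_inverse)
    then have "?w (Suc i) = map (v i) [0..<j] @ v (Suc i) j # map (v (Suc i)) [Suc j..<N]"
      "?w i = map (v i) [0..<j] @ v i j # map (v i) [Suc j..<N]"
      using j(2) by auto
    moreover have "length (?w (Suc i)) = N" "length (?w i) = N"
      by auto
    ultimately show ?thesis
      unfolding lexn_conv using j(1) by (simp del: length_map map_map) blast
  qed
  then have "\<exists>f. \<forall>i. (f (Suc i), f i) \<in> lexn less_than N"
    by (intro exI[of _ ?w]) blast
  then show False
    using wf_lexn[OF wf_less_than, of N] unfolding wf_iff_no_infinite_down_chain by blast
qed

text \<open>
  The rank of the first term bounds the length of all the count vectors in the sequence. The
  assignment to the ambient variables is arbitrary here, so it can be taken to be zero.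
\<close>

lemma red_tm_terminates: "\<nexists>f :: nat \<Rightarrow> 'v tm. \<forall>i. f i \<leadsto>\<^sub>t\<^sub>m f (Suc i)"
proof
  assume "\<exists>f :: nat \<Rightarrow> 'v tm. \<forall>i. f i \<leadsto>\<^sub>t\<^sub>m f (Suc i)"
  then obtain f :: "nat \<Rightarrow> 'v tm" where f: "\<And>i. f i \<leadsto>\<^sub>t\<^sub>m f (Suc i)"
    by blast
  let ?e = "\<lambda>_ :: 'v. 0 :: nat"
  have step: "rank_tm (f (Suc i)) ?e \<le> rank_tm (f i) ?e \<and> lex_decreases (cohs_tm (f i)) (cohs_tm (f (Suc i)))" for i
  proof -
    obtain s t where "alpha_tm (f i) s" "step_tm s t" "alpha_tm t (f (Suc i))"
      using f[of i] unfolding red_tm_def by blast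
    then show ?thesis
      using alpha_measures(2) step_measures(3) by metis
  qed
  have rank: "rank_tm (f i) ?e \<le> rank_tm (f 0) ?e" for i
    by (induction i) (use step in \<open>auto intro: le_trans\<close>)
  show False
  proof (rule no_infinite_lex_descent)
    show "lex_decreases (cohs_tm (f i)) (cohs_tm (f (Suc i)))" for i
      using step by blast
    show "cohs_tm (f i) j = 0" if "rank_tm (f 0) ?e \<le> j" for i j
      using cohs_imp_rank(2)[of "f i" j ?e] rank[of i] that by linarith
  qed
qed

text \<open>
  Types and substitutions are treated by making them parts of a term. The prefix \<open>\<rho>\<close>
  collects the entries that have been renamed already, as the congruence acts on one entry at a time.
\<close>

lemma alpha_sub_Coh: "alpha_sub \<sigma> \<sigma>' \<Longrightarrow> alpha_tm (Coh \<Gamma> A (\<rho> @ \<sigma>)) (Coh \<Gamma> A (\<rho> @ \<sigma>'))"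
  unfolding alpha_sub_def
proof (induction \<sigma> \<sigma>' arbitrary: \<rho> rule: list_all2_induct)
  case (Cons p \<sigma> q \<sigma>')
  obtain x t t' where p: "p = (x, t)" "q = (x, t')" "alpha_tm t t'"
    using Cons(1) by (cases p; cases q) auto
  have "alpha_tm (Coh \<Gamma> A (\<rho> @ p # \<sigma>)) (Coh \<Gamma> A (\<rho> @ q # \<sigma>))"
    using p alpha_coh_sub by metis
  moreover have "alpha_tm (Coh \<Gamma> A ((\<rho> @ [q]) @ \<sigma>)) (Coh \<Gamma> A ((\<rho> @ [q]) @ \<sigma>'))"
    by (rule Cons.IH)
  ultimately show ?case
    using alpha_tm_trans by simp
qed (simp add: alpha_tm_refl)

lemma red_ty_Coh: "A \<leadsto>\<^sub>t\<^sub>y B \<Longrightarrow> Coh \<Gamma> A \<sigma> \<leadsto>\<^sub>t\<^sub>m Coh \<Gamma> B \<sigma>"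
  unfolding red_ty_def red_tm_def by (meson alpha_coh_ty step_coh_ty)

lemma red_sub_Coh: "\<sigma> \<leadsto>\<^sub>s \<tau> \<Longrightarrow> Coh \<Gamma> A \<sigma> \<leadsto>\<^sub>t\<^sub>m Coh \<Gamma> A \<tau>"
  unfolding red_sub_def red_tm_def using alpha_sub_Coh[of _ _ \<Gamma> A "[]"]
  by (metis append_Nil step_coh_sub)

theorem theorem44:
  assumes "infinite (UNIV :: 'v set)"
  shows "(\<nexists>f :: nat \<Rightarrow> 'v tm. \<forall>i. f i \<leadsto>\<^sub>t\<^sub>m f (Suc i)) \<and>
         (\<nexists>f :: nat \<Rightarrow> 'v ty. \<forall>i. f i \<leadsto>\<^sub>t\<^sub>y f (Suc i)) \<and>
         (\<nexists>f :: nat \<Rightarrow> 'v sub. \<forall>i. f i \<leadsto>\<^sub>s f (Suc i))"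
proof (intro conjI notI)
  assume "\<exists>f :: nat \<Rightarrow> 'v tm. \<forall>i. f i \<leadsto>\<^sub>t\<^sub>m f (Suc i)"
  then show False
    using red_tm_terminates by blast
next
  assume "\<exists>f :: nat \<Rightarrow> 'v ty. \<forall>i. f i \<leadsto>\<^sub>t\<^sub>y f (Suc i)"
  then obtain f :: "nat \<Rightarrow> 'v ty" where "\<forall>i. f i \<leadsto>\<^sub>t\<^sub>y f (Suc i)"
    by blast
  then have "\<forall>i. Coh [] (f i) [] \<leadsto>\<^sub>t\<^sub>m Coh [] (f (Suc i)) []"
    using red_ty_Coh by blast
  then show False
    using red_tm_terminates[unfolded not_ex, rule_format, of "\<lambda>i. Coh [] (f i) []"] by simp
next
  assume "\<exists>f :: nat \<Rightarrow> 'v sub. \<forall>i. f i \<leadsto>\<^sub>s f (Suc i)"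
  then obtain f :: "nat \<Rightarrow> 'v sub" where "\<forall>i. f i \<leadsto>\<^sub>s f (Suc i)"
    by blast
  then have "\<forall>i. Coh [] Star (f i) \<leadsto>\<^sub>t\<^sub>m Coh [] Star (f (Suc i))"
    using red_sub_Coh by blast
  then show False
    using red_tm_terminates[unfolded not_ex, rule_format, of "\<lambda>i. Coh [] Star (f i)"] by simp
qed

end
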